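(* Let $F>0$ be smooth on $\mathbb R$ with $F'>0$ and $F_-:=\lim_{t\to-\infty}F(t)=\inf_{\mathbb R}F>0$. Fix $c\in\mathbb R$ and $\varepsilon>0$, and let $V_c(s)=\sec^2s+c^2\csc^2s$ for $0<s<\pi/2$. The equation $$(s')^2=1-\frac{\varepsilon V_c(s)}{F(t)^2},\qquad 0<s<\pi/2,\tag{$*$}$$ has a smooth entire solution (a smooth solution defined for all $t\in\mathbb R$) if and only if $$\sqrt\varepsilon\,(1+|c|)\le F_-.$$ Assume this inequality. For $c\ne0$, there are unique entire solutions of $( * )$ in the respective half-strips $$s_c<s^U<U,\quad (s^U)'>0,\qquad\qquad L<s^L<s_c,\quad (s^L)'<0.$$ Set $U_\pm=\lim_{t\to\pm\infty}U(t)$ and $L_\pm=\lim_{t\to\pm\infty}L(t)$. The two branches satisfy $$\lim_{t\to-\infty}s^U(t)=U_-,\quad\lim_{t\to+\infty}s^U(t)=U_+,\quad\lim_{t\to-\infty}s^L(t)=L_-,\quad\lim_{t\to+\infty}s^L(t)=L_+.$$ For $c=0$, there is exactly one entire solution $s^U$ with $0<s^U<U$ and $(s^U)'>0$, and its limits as $t\to\mp\infty$ are $U_-$ and $U_+$ respectively. If $F_+:=\lim_{t\to\infty}F(t)=\infty$, then $U_+=\pi/2$; and for $c\ne0$, also $L_+=0$.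
   Context: For $c\neq0$, $V_c$ has its minimum $(1+|c|)^2$ on $(0,\pi/2)$ at $s_c=\arctan\sqrt{|c|}$. When $F(t)>\sqrt\varepsilon(1+|c|)$, the two roots in $(0,\pi/2)$ of $\varepsilon V_c(s)=F(t)^2$ are denoted $L(t)<s_c<U(t)$. For $c=0$ put $s_c=0$ and $U(t)=\arccos(\sqrt\varepsilon/F(t))$ for $F(t)>\sqrt\varepsilon$ (the admissible interval is $0<s\le U(t)$). *)

theory Defs
  imports "HOL-Analysis.Analysis"
begin

definition smooth_real :: "(real \<Rightarrow> real) \<Rightarrow> bool" where
  "smooth_real f \<longleftrightarrow> (\<forall>n t. (deriv ^^ n) f differentiable (at t))"

definition V :: "real \<Rightarrow> real \<Rightarrow> real" where
  "V c s = 1 / (cos s)\<^sup>2 + c\<^sup>2 * (1 / (sin s)\<^sup>2)"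

definition s_crit :: "real \<Rightarrow> real" where
  "s_crit c = arctan (sqrt \<bar>c\<bar>)"

text \<open>For \<open>c \<noteq> 0\<close>, the definite descriptions are well defined when
  \<open>F t > sqrt \<epsilon> * (1 + \<bar>c\<bar>)\<close> (and unspecified otherwise); see \<open>ex1_upper_root\<close> and \<open>ex1_lower_root\<close>.\<close>

definition upper_root :: "(real \<Rightarrow> real) \<Rightarrow> real \<Rightarrow> real \<Rightarrow> real \<Rightarrow> real" where
  "upper_root F \<epsilon> c t =
     (if c = 0 then arccos (sqrt \<epsilon> / F t)
      else (THE s. s_crit c < s \<and> s < pi / 2 \<and> \<epsilon> * V c s = (F t)\<^sup>2))"

definition lower_root :: "(real \<Rightarrow> real) \<Rightarrow> real \<Rightarrow> real \<Rightarrow> real \<Rightarrow> real" where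
  "lower_root F \<epsilon> c t =
     (THE s. 0 < s \<and> s < s_crit c \<and> \<epsilon> * V c s = (F t)\<^sup>2)"

definition entire_solution :: "(real \<Rightarrow> real) \<Rightarrow> real \<Rightarrow> real \<Rightarrow> (real \<Rightarrow> real) \<Rightarrow> bool" where
  "entire_solution F \<epsilon> c s \<longleftrightarrow>
     smooth_real s \<and>
     (\<forall>t. 0 < s t \<and> s t < pi / 2 \<and>
          (deriv s t)\<^sup>2 = 1 - \<epsilon> * V c (s t) / (F t)\<^sup>2)"

definition upper_branch :: "(real \<Rightarrow> real) \<Rightarrow> real \<Rightarrow> real \<Rightarrow> (real \<Rightarrow> real) \<Rightarrow> bool" where
  "upper_branch F \<epsilon> c s \<longleftrightarrow>
     entire_solution F \<epsilon> c s \<and>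
     (\<forall>t. s_crit c < s t \<and> s t < upper_root F \<epsilon> c t \<and> deriv s t > 0)"

definition lower_branch :: "(real \<Rightarrow> real) \<Rightarrow> real \<Rightarrow> real \<Rightarrow> (real \<Rightarrow> real) \<Rightarrow> bool" where
  "lower_branch F \<epsilon> c s \<longleftrightarrow>
     entire_solution F \<epsilon> c s \<and>
     (\<forall>t. lower_root F \<epsilon> c t < s t \<and> s t < s_crit c \<and> deriv s t < 0)"

lemma s_crit_zero [simp]: "s_crit 0 = 0"
  by (simp add: s_crit_def)

lemma V_eq_tan:
  assumes "0 < s" "s < pi / 2"
  shows "V c s = (1 + \<bar>c\<bar>)\<^sup>2 + (tan s - \<bar>c\<bar> / tan s)\<^sup>2"
proof -
  have p: "cos s > 0" "sin s > 0"
    using assms by (auto intro: cos_gt_zero sin_gt_zero2)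
  have 1: "1 / (cos s)\<^sup>2 = 1 + (tan s)\<^sup>2"
    using p sin_cos_squared_add[of s] by (simp add: tan_def field_simps)
  have 2: "1 / (sin s)\<^sup>2 = 1 + 1 / (tan s)\<^sup>2"
    using p sin_cos_squared_add[of s] by (simp add: tan_def field_simps)
  have t: "tan s > 0" using assms by (simp add: tan_gt_zero)
  have "(tan s - \<bar>c\<bar> / tan s)\<^sup>2 = (tan s)\<^sup>2 - 2 * \<bar>c\<bar> + c\<^sup>2 * (1 / (tan s)\<^sup>2)"
    using t by (simp add: power2_diff power_divide)
  then show ?thesis
    unfolding V_def 1 2 by (simp add: power2_sum algebra_simps)
qed

lemma V_minimum:
  assumes "c \<noteq> 0"
  shows "0 < s_crit c" "s_crit c < pi / 2" "V c (s_crit c) = (1 + \<bar>c\<bar>)\<^sup>2"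
    "\<And>s. 0 < s \<Longrightarrow> s < pi / 2 \<Longrightarrow> V c (s_crit c) \<le> V c s"
proof -
  show a: "0 < s_crit c" using assms by (simp add: s_crit_def zero_less_arctan_iff)
  show b: "s_crit c < pi / 2" unfolding s_crit_def by (rule arctan_ubound)
  show e: "V c (s_crit c) = (1 + \<bar>c\<bar>)\<^sup>2"
    using V_eq_tan[OF a b] assms by (simp add: s_crit_def tan_arctan real_div_sqrt)
  show "V c (s_crit c) \<le> V c s" if "0 < s" "s < pi / 2" for s
    unfolding e V_eq_tan[OF that] by simp
qed

lemma tan_gap_sign:
  assumes "0 < s" "s < pi / 2"
  shows "s_crit c < s \<longleftrightarrow> tan s - \<bar>c\<bar> / tan s > 0"
    and "s < s_crit c \<longleftrightarrow> tan s - \<bar>c\<bar> / tan s < 0"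
proof -
  have t: "tan s > 0" using assms by (simp add: tan_gt_zero)
  have s: "s = arctan (tan s)" using assms by (simp add: arctan_tan)
  have q: "tan s = sqrt ((tan s)\<^sup>2)" using t by simp
  have "s_crit c < s \<longleftrightarrow> sqrt \<bar>c\<bar> < tan s"
    by (subst s) (simp add: s_crit_def arctan_less_iff)
  also have "\<dots> \<longleftrightarrow> \<bar>c\<bar> < (tan s)\<^sup>2" by (subst q) (simp only: real_sqrt_less_iff)
  finally show "s_crit c < s \<longleftrightarrow> tan s - \<bar>c\<bar> / tan s > 0"
    using t by (simp add: field_simps power2_eq_square)
  have "s < s_crit c \<longleftrightarrow> tan s < sqrt \<bar>c\<bar>"
    by (subst s) (simp add: s_crit_def arctan_less_iff)
  also have "\<dots> \<longleftrightarrow> (tan s)\<^sup>2 < \<bar>c\<bar>" by (subst q) (simp only: real_sqrt_less_iff)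
  finally show "s < s_crit c \<longleftrightarrow> tan s - \<bar>c\<bar> / tan s < 0"
    using t by (simp add: field_simps power2_eq_square)
qed

lemma ex1_tan_gap:
  fixes d c :: real
  assumes "c \<noteq> 0"
  shows "\<exists>!s. 0 < s \<and> s < pi / 2 \<and> tan s - \<bar>c\<bar> / tan s = d"
proof (rule ex_ex1I)
  define x where "x = (d + sqrt (d\<^sup>2 + 4 * \<bar>c\<bar>)) / 2"
  have "sqrt (d\<^sup>2) < sqrt (d\<^sup>2 + 4 * \<bar>c\<bar>)" using assms by (subst real_sqrt_less_iff) simp
  then have x: "x > 0" by (simp add: x_def)
  have "2 * x - d = sqrt (d\<^sup>2 + 4 * \<bar>c\<bar>)" by (simp add: x_def field_simps)
  then have "(2 * x - d)\<^sup>2 = d\<^sup>2 + 4 * \<bar>c\<bar>" by simp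
  then have "x - \<bar>c\<bar> / x = d" using x by (simp add: field_simps power2_eq_square)
  then show "\<exists>s. 0 < s \<and> s < pi / 2 \<and> tan s - \<bar>c\<bar> / tan s = d"
    using x arctan_ubound[of x] by (intro exI[of _ "arctan x"]) (simp add: tan_arctan zero_less_arctan_iff)
next
  have less: "tan s - \<bar>c\<bar> / tan s < tan r - \<bar>c\<bar> / tan r"
    if "0 < s" "s < r" "r < pi / 2" for s r
  proof -
    have "0 < tan s" "tan s < tan r" using that by (auto intro: tan_gt_zero tan_monotone)
    moreover have "\<bar>c\<bar> / tan r \<le> \<bar>c\<bar> / tan s"
      using calculation by (intro divide_left_mono) auto
    ultimately show ?thesis by linarith
  qed
  fix s r
  assume "0 < s \<and> s < pi / 2 \<and> tan s - \<bar>c\<bar> / tan s = d"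
    "0 < r \<and> r < pi / 2 \<and> tan r - \<bar>c\<bar> / tan r = d"
  then show "s = r" using less[of s r] less[of r s] by linarith
qed

context
  fixes \<epsilon> c y :: real
  assumes c: "c \<noteq> 0" and eps: "\<epsilon> > 0" and y: "sqrt \<epsilon> * (1 + \<bar>c\<bar>) < y"
begin

private definition "d = sqrt (y\<^sup>2 / \<epsilon> - (1 + \<bar>c\<bar>)\<^sup>2)"

private lemma d_sq: "d\<^sup>2 = y\<^sup>2 / \<epsilon> - (1 + \<bar>c\<bar>)\<^sup>2" and d_pos: "d > 0"
proof -
  have "(sqrt \<epsilon> * (1 + \<bar>c\<bar>))\<^sup>2 < y\<^sup>2" using y eps by (intro power_strict_mono) auto
  then have "y\<^sup>2 / \<epsilon> - (1 + \<bar>c\<bar>)\<^sup>2 > 0"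
    using eps by (simp add: power_mult_distrib pos_less_divide_eq mult.commute)
  then show "d\<^sup>2 = y\<^sup>2 / \<epsilon> - (1 + \<bar>c\<bar>)\<^sup>2" "d > 0" by (auto simp: d_def)
qed

private lemma root_iff:
  assumes "0 < s" "s < pi / 2"
  shows "\<epsilon> * V c s = y\<^sup>2 \<longleftrightarrow>
    tan s - \<bar>c\<bar> / tan s = d \<or> tan s - \<bar>c\<bar> / tan s = - d"
proof -
  have "\<epsilon> * V c s = y\<^sup>2 \<longleftrightarrow> V c s = y\<^sup>2 / \<epsilon>" using eps by (auto simp: field_simps)
  also have "\<dots> \<longleftrightarrow> (tan s - \<bar>c\<bar> / tan s)\<^sup>2 = d\<^sup>2"
    unfolding V_eq_tan[OF assms] d_sq by auto
  finally show ?thesis by (simp add: power2_eq_iff)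
qed

lemma ex1_upper_root: "\<exists>!s. s_crit c < s \<and> s < pi / 2 \<and> \<epsilon> * V c s = y\<^sup>2"
proof -
  have "(s_crit c < s \<and> s < pi / 2 \<and> \<epsilon> * V c s = y\<^sup>2) \<longleftrightarrow>
        (0 < s \<and> s < pi / 2 \<and> tan s - \<bar>c\<bar> / tan s = d)" for s
    using root_iff[of s] tan_gap_sign(1)[of s c] V_minimum(1)[OF c] d_pos by (smt (verit))
  then show ?thesis using ex1_tan_gap[OF c, of d] by simp
qed

lemma ex1_lower_root: "\<exists>!s. 0 < s \<and> s < s_crit c \<and> \<epsilon> * V c s = y\<^sup>2"
proof -
  have "(0 < s \<and> s < s_crit c \<and> \<epsilon> * V c s = y\<^sup>2) \<longleftrightarrow>
        (0 < s \<and> s < pi / 2 \<and> tan s - \<bar>c\<bar> / tan s = - d)" for s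
    using root_iff[of s] tan_gap_sign(2)[of s c] V_minimum(2)[OF c] d_pos by (smt (verit))
  then show ?thesis using ex1_tan_gap[OF c, of "- d"] by simp
qed

end

end

theory Submission
  imports Defs
begin

text \<open>
  On \<open>s_crit c \<le> s < pi / 2\<close> the right-hand side of \<open>s' = sqrt (1 - \<epsilon> * V c s / (F t)\<^sup>2)\<close> is
  decreasing in \<open>s\<close>. The pointwise supremum of the nondecreasing subsolutions between \<open>s_crit c\<close> and
  \<open>U\<close> is an entire solution (Perron's method). It cannot touch \<open>s_crit c\<close>, where its slope would be
  positive, nor \<open>U\<close>, because \<open>1 - \<epsilon> * V c s / (F t)\<^sup>2\<close> would vanish there with positive derivative
  and hence be negative just before. Its smoothness follows by repeated differentiation of the equation.
  A monotone bounded solution has a limit at each end, where its slope must tend to \<open>0\<close>; this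
  identifies the limits. For two solutions \<open>(s - r)\<^sup>2\<close> is nonincreasing and tends to \<open>0\<close> at
  \<open>-\<infinity>\<close>, so they coincide. The lower branch is the reflection \<open>pi / 2 - s\<close> of
  the upper branch for the parameters \<open>\<epsilon> * c\<^sup>2\<close> and \<open>1 / c\<close>.
\<close>

subsection \<open>Smoothness from a derivative-closed algebra\<close>

text \<open>Reciprocals and roots are not operations of the algebra but get adjoined as generators.
  Differentiation then involves only the sum and Leibniz rules.\<close>

inductive_set func_algebra :: "(real \<Rightarrow> real) set \<Rightarrow> (real \<Rightarrow> real) set"
  for B :: "(real \<Rightarrow> real) set" where
  base: "b \<in> B \<Longrightarrow> b \<in> func_algebra B"
| const: "(\<lambda>_. k) \<in> func_algebra B"
| add: "f \<in> func_algebra B \<Longrightarrow> g \<in> func_algebra B \<Longrightarrow> (\<lambda>t. f t + g t) \<in> func_algebra B"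
| mult: "f \<in> func_algebra B \<Longrightarrow> g \<in> func_algebra B \<Longrightarrow> (\<lambda>t. f t * g t) \<in> func_algebra B"

lemma func_algebra_power: "f \<in> func_algebra B \<Longrightarrow> (\<lambda>t. f t ^ n) \<in> func_algebra B"
  by (induction n) (auto intro: func_algebra.intros)

lemmas func_algebra_closed =
  func_algebra.const func_algebra.add func_algebra.mult func_algebra_power

text \<open>By the sum and product rules, closure under differentiation is inherited from the
  generators.\<close>

lemma func_algebra_has_derivative:
  assumes B: "\<And>b. b \<in> B \<Longrightarrow> \<exists>b'\<in>func_algebra B. \<forall>t. (b has_real_derivative b' t) (at t)"
    and f: "f \<in> func_algebra B"
  shows "\<exists>f'\<in>func_algebra B. \<forall>t. (f has_real_derivative f' t) (at t)"
  using f
proof induction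
  case (base b)
  then show ?case by (rule B)
next
  case (const k)
  show ?case
    by (rule bexI[of _ "\<lambda>_. 0"]) (auto intro: func_algebra.const)
next
  case (add f g)
  then obtain f' g' where "f' \<in> func_algebra B" "g' \<in> func_algebra B"
    "\<And>t. (f has_real_derivative f' t) (at t)" "\<And>t. (g has_real_derivative g' t) (at t)"
    by blast
  then show ?case
    by (intro bexI[of _ "\<lambda>t. f' t + g' t"]) (auto intro: func_algebra.add DERIV_add)
next
  case (mult f g)
  then obtain f' g' where "f' \<in> func_algebra B" "g' \<in> func_algebra B"
    "\<And>t. (f has_real_derivative f' t) (at t)" "\<And>t. (g has_real_derivative g' t) (at t)"
    by blast
  with mult show ?case
    by (intro bexI[of _ "\<lambda>t. f' t * g t + g' t * f t"])
       (auto intro: func_algebra.intros DERIV_mult)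
qed

text \<open>Each iterated derivative stays in the algebra, and every member of the algebra is
  differentiable everywhere.\<close>

lemma smooth_real_func_algebra:
  assumes B: "\<And>b. b \<in> B \<Longrightarrow> \<exists>b'\<in>func_algebra B. \<forall>t. (b has_real_derivative b' t) (at t)"
    and f: "f \<in> func_algebra B"
  shows "smooth_real f"
proof -
  have mem: "(deriv ^^ n) f \<in> func_algebra B" for n
  proof (induction n)
    case (Suc n)
    from func_algebra_has_derivative[OF B Suc] obtain f' where
      f': "f' \<in> func_algebra B" "\<And>t. ((deriv ^^ n) f has_real_derivative f' t) (at t)" by blast
    then have "deriv ((deriv ^^ n) f) = f'" by (intro ext DERIV_imp_deriv)
    with f' show ?case by simp
  qed (simp add: f)
  show ?thesis
    unfolding smooth_real_def
    using func_algebra_has_derivative[OF B mem] real_differentiable_def by blast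
qed

lemma smooth_real_DERIV_funpow:
  assumes "smooth_real f"
  shows "((deriv ^^ n) f has_real_derivative (deriv ^^ Suc n) f t) (at t)"
  using assms unfolding smooth_real_def
  by (metis DERIV_deriv_iff_real_differentiable comp_apply funpow.simps(2))

lemma smooth_real_DERIV:
  assumes "smooth_real f"
  shows "(f has_real_derivative deriv f t) (at t)"
  using smooth_real_DERIV_funpow[OF assms, of 0] by simp

text \<open>The iterated derivatives of \<open>f\<close> generate an algebra closed under
  differentiation. The case \<open>k = pi / 2\<close> serves the reflection that yields the lower
  branch.\<close>

lemma smooth_real_diff_const:
  assumes "smooth_real f"
  shows "smooth_real (\<lambda>t. k - f t)"
proof -
  define B where "B = range (\<lambda>n. (deriv ^^ n) f)"
  have f: "f \<in> func_algebra B"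
    unfolding B_def by (rule func_algebra.base) (metis funpow_0 rangeI)
  have "smooth_real (\<lambda>t. k + (-1) * f t)"
  proof (rule smooth_real_func_algebra[of B])
    fix b assume "b \<in> B"
    then obtain n where "b = (deriv ^^ n) f" by (auto simp: B_def)
    then show "\<exists>b'\<in>func_algebra B. \<forall>t. (b has_real_derivative b' t) (at t)"
      using smooth_real_DERIV_funpow[OF assms, of n]
      by (intro bexI[of _ "(deriv ^^ Suc n) f"] func_algebra.base) (auto simp: B_def simp del: funpow.simps)
  qed (intro func_algebra.add func_algebra.mult func_algebra.const f)
  then show ?thesis by simp
qed

subsection \<open>Entire solutions by Perron's method\<close>

text \<open>\<open>W\<close> is the pointwise supremum of a class of nondecreasing subsolutions.
  Near-maximal members bound its slope from above; appending a straight segment to such a member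
  bounds it from below. As \<open>f\<close> is positive nowhere above \<open>U\<close>, the segment
  cannot leave the strip.\<close>

lemma perron_entire_solution:
  fixes f :: "real \<Rightarrow> real \<Rightarrow> real" and U :: "real \<Rightarrow> real" and a :: real
  assumes aU: "\<And>t. a \<le> U t" and U_mono: "mono U"
    and f_bounds: "\<And>t y. a \<le> y \<Longrightarrow> 0 \<le> f t y \<and> f t y \<le> 1"
    and f_pos: "\<And>t y. a \<le> y \<Longrightarrow> 0 < f t y \<Longrightarrow> y \<le> U t"
    and f_cont: "\<And>t y. a \<le> y \<Longrightarrow> y \<le> U t \<Longrightarrow> isCont (\<lambda>p. f (fst p) (snd p)) (t, y)"
  shows "\<exists>W. \<forall>t. a \<le> W t \<and> W t \<le> U t \<and> (W has_real_derivative f t (W t)) (at t)"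
proof -
  \<comment> \<open>Subsolutions in mean-value form: an increment is at most the length of the
    interval times any bound of \<open>f\<close> along \<open>w\<close>. No derivative of
    \<open>w\<close> occurs, so functions with corners belong to \<open>S\<close> and pieces can be
    joined.\<close>
  define S where "S = {w. mono w \<and> (\<forall>t. a \<le> w t \<and> w t \<le> U t) \<and>
    (\<forall>r t M. r \<le> t \<longrightarrow> (\<forall>\<tau>\<in>{r..t}. f \<tau> (w \<tau>) \<le> M) \<longrightarrow> w t - w r \<le> M * (t - r))}"
  have aS: "(\<lambda>_. a) \<in> S"
  proof -
    have "0 \<le> M * (t - r)" if "r \<le> t" "\<forall>\<tau>\<in>{r..t}. f \<tau> a \<le> M" for r t M
    proof -
      have "f r a \<le> M" using that by auto
      then have "0 \<le> M" using f_bounds[of a r] by force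
      then show ?thesis using that by simp
    qed
    then show ?thesis by (auto simp: S_def aU mono_def)
  qed
  have S_mono: "w r \<le> w t" if "w \<in> S" "r \<le> t" for w r t
    using that by (auto simp: S_def mono_def)
  have S_ge: "a \<le> w t" and S_le: "w t \<le> U t" if "w \<in> S" for w t
    using that by (auto simp: S_def)
  have S_slope: "w t - w r \<le> M * (t - r)" if "w \<in> S" "r \<le> t" "\<And>\<tau>. r \<le> \<tau> \<Longrightarrow> \<tau> \<le> t \<Longrightarrow> f \<tau> (w \<tau>) \<le> M" for w r t M
    using that by (auto simp: S_def)
  have S_lip: "w t - w r \<le> t - r" if "w \<in> S" "r \<le> t" for w r t
    using S_slope[OF that, of 1] f_bounds[OF S_ge[OF that(1)]] by simp
  define W where "W t = (SUP w\<in>S. w t)" for t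
  have bdd: "bdd_above ((\<lambda>w. w t) ` S)" for t
    using S_le by (auto intro!: bdd_aboveI2)
  have W_upper: "w t \<le> W t" if "w \<in> S" for w t
    unfolding W_def using that bdd by (rule cSUP_upper)
  have W_least: "W t \<le> x" if "\<And>w. w \<in> S \<Longrightarrow> w t \<le> x" for t x
    unfolding W_def using that aS by (intro cSUP_least) auto
  have W_approx: "\<exists>w\<in>S. W t - \<eta> < w t" if "\<eta> > 0" for t \<eta>
    using W_least[of t "W t - \<eta>"] that by fastforce
  have W_ge: "a \<le> W t" for t using W_upper[OF aS] .
  have W_le: "W t \<le> U t" for t by (rule W_least) (rule S_le)
  have W_mono: "W r \<le> W t" if "r \<le> t" for r t
    by (rule W_least) (use W_upper S_mono that order_trans in blast)
  have W_lip: "W t \<le> W r + (t - r)" if "r \<le> t" for r t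
  proof (rule W_least)
    fix w assume w: "w \<in> S"
    show "w t \<le> W r + (t - r)" using S_lip[OF w that] W_upper[OF w, of r] by linarith
  qed
  have "(W has_real_derivative f t0 (W t0)) (at t0)" for t0
  proof -
    define f0 where "f0 = f t0 (W t0)"
    \<comment> \<open>Near \<open>t0\<close> all increments are squeezed between slopes
      \<open>f0 - e\<close> and \<open>f0 + e\<close>; with \<open>r = t0\<close> or
      \<open>t = t0\<close> this gives the two one-sided derivatives.\<close>
    have "\<exists>\<eta>>0. \<forall>r t. t0 - \<eta> < r \<longrightarrow> r \<le> t \<longrightarrow> t < t0 + \<eta> \<longrightarrow>
        (f0 - e) * (t - r) \<le> W t - W r \<and> W t - W r \<le> (f0 + e) * (t - r)" if e: "e > 0" for e
    proof -
      from f_cont[OF W_ge W_le, of t0] e obtain \<delta> where \<delta>: "\<delta> > 0" and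
        near: "\<And>p. dist p (t0, W t0) < \<delta> \<Longrightarrow> dist (f (fst p) (snd p)) f0 < e"
        unfolding continuous_at_eps_delta f0_def fst_conv snd_conv by blast
      \<comment> \<open>The distance in the plane is at most the sum of the coordinate distances, so
        \<open>8 * \<eta>\<close> in each coordinate stays within \<open>\<delta>\<close>.\<close>
      define \<eta> where "\<eta> = \<delta> / 16"
      have \<eta>: "\<eta> > 0" "16 * \<eta> = \<delta>" using \<delta> by (auto simp: \<eta>_def)
      have fnear: "f0 - e < f \<tau> y \<and> f \<tau> y < f0 + e"
        if "\<bar>\<tau> - t0\<bar> < 8 * \<eta>" "\<bar>y - W t0\<bar> < 8 * \<eta>" for \<tau> y
      proof -
        have "dist (\<tau>, y) (t0, W t0) \<le> \<bar>\<tau> - t0\<bar> + \<bar>y - W t0\<bar>"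
          by (simp add: dist_Pair_Pair dist_real_def sqrt_sum_squares_le_sum_abs)
        then have "dist (\<tau>, y) (t0, W t0) < \<delta>" using that \<eta>(2) by linarith
        from near[OF this] show ?thesis by (simp add: dist_real_def abs_less_iff)
      qed
      have Wnear: "\<bar>W t - W t0\<bar> < \<eta>" if "t0 - \<eta> < t" "t < t0 + \<eta>" for t
        using W_mono[of t t0] W_mono[of t0 t] W_lip[of t t0] W_lip[of t0 t] that by linarith
      \<comment> \<open>A member \<open>w\<close> nearly maximal at the right end \<open>t\<close>
        stays close to \<open>W t0\<close> on all of \<open>{r..t}\<close>, being nondecreasing with
        slope at most \<open>1\<close>. So \<open>f\<close> along it is at most
        \<open>f0 + e\<close>, and its increment bounds that of \<open>W\<close> up to the error
        \<open>\<eta>'\<close>.\<close>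
      have up: "W t - W r \<le> (f0 + e) * (t - r)" if rt: "t0 - \<eta> < r" "r \<le> t" "t < t0 + \<eta>" for r t
      proof (rule field_le_epsilon)
        fix \<eta>' :: real assume "\<eta>' > 0"
        then obtain w where w: "w \<in> S" "W t - min \<eta> \<eta>' < w t"
          using W_approx[of "min \<eta> \<eta>'"] \<eta> by auto
        have "w t - w r \<le> (f0 + e) * (t - r)"
        proof (rule S_slope[OF w(1) rt(2)])
          fix \<tau> assume \<tau>: "r \<le> \<tau>" "\<tau> \<le> t"
          have "\<bar>w \<tau> - W t0\<bar> < 8 * \<eta>"
            using S_lip[OF w(1) \<tau>(2)] W_upper[OF w(1), of \<tau>] Wnear[of \<tau>] Wnear[of t] w(2) \<tau> rt
            by linarith
          then show "f \<tau> (w \<tau>) \<le> f0 + e" using fnear[of \<tau> "w \<tau>"] \<tau> rt \<eta> by linarith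
        qed
        then show "W t - W r \<le> (f0 + e) * (t - r) + \<eta>'"
          using w(2) W_upper[OF w(1), of r] by linarith
      qed
      have low: "(f0 - e) * (t - r) \<le> W t - W r" if rt: "t0 - \<eta> < r" "r \<le> t" "t < t0 + \<eta>" for r t
      proof (cases "f0 - e \<le> 0")
        case True
        then show ?thesis
          using W_mono[OF rt(2)] rt(2) mult_nonpos_nonneg[of "f0 - e" "t - r"] by linarith
      next
        case False
        define m where "m = f0 - e"
        have m: "0 < m" "m \<le> 1"
          using False e f_bounds[OF W_ge, of t0 t0] by (auto simp: m_def f0_def)
        show ?thesis
        proof (rule field_le_epsilon)
          fix \<eta>' :: real assume "\<eta>' > 0"
          then obtain w where w: "w \<in> S" "W r - min \<eta> \<eta>' < w r"
            using W_approx[of "min \<eta> \<eta>'"] \<eta> by auto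
          \<comment> \<open>Continuing \<open>w\<close> beyond \<open>r\<close> with a slope below \<open>f0\<close> stays in \<open>S\<close>, hence below \<open>W\<close>.\<close>
          define w' where "w' \<tau> = (if \<tau> \<le> r then w \<tau> else w r + m * (min \<tau> t - r))" for \<tau>
          have w'_r: "w' \<tau> = w r + m * (\<tau> - r)" if "r \<le> \<tau>" "\<tau> \<le> t" for \<tau>
            using that by (auto simp: w'_def min_def)
          have w'_t: "w' \<tau> = w' t" if "t \<le> \<tau>" for \<tau>
            using that rt(2) by (auto simp: w'_def min_def)
          have w'_mono: "mono w'"
          proof (rule monoI)
            fix x y :: real assume xy: "x \<le> y"
            show "w' x \<le> w' y"
              using S_mono[OF w(1), of x r] S_mono[OF w(1), of x y] xy m(1) rt(2)
              by (auto simp: w'_def intro!: add_increasing2 mult_left_mono)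
          qed
          have w'_ge: "a \<le> w' \<tau>" for \<tau>
            using S_ge[OF w(1)] m rt(2) by (auto simp: w'_def intro!: add_increasing2)
          \<comment> \<open>The segment has slope \<open>m \<le> 1\<close> and starts near
            \<open>(t0, W t0)\<close>, so it stays in the region where \<open>f\<close> exceeds
            \<open>m\<close>. This makes the slope admissible for a subsolution.\<close>
          have fw': "m < f \<tau> (w' \<tau>)" if \<tau>: "r \<le> \<tau>" "\<tau> \<le> t" for \<tau>
          proof -
            have "0 \<le> m * (\<tau> - r)" "m * (\<tau> - r) \<le> 1 * (\<tau> - r)"
              using m \<tau> by (simp, intro mult_right_mono) simp_all
            then have "w r \<le> w' \<tau>" "w' \<tau> \<le> w r + (\<tau> - r)"
              unfolding w'_r[OF \<tau>] by auto
            moreover have "\<bar>W r - W t0\<bar> < \<eta>" using Wnear rt by simp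
            ultimately have "\<bar>w' \<tau> - W t0\<bar> < 8 * \<eta>"
              using W_upper[OF w(1), of r] w(2) rt \<tau> by linarith
            then show ?thesis using fnear[of \<tau> "w' \<tau>"] rt \<tau> \<eta> by (auto simp: m_def)
          qed
          \<comment> \<open>Positivity of \<open>f\<close> along the segment places it below
            \<open>U\<close>. After \<open>t\<close> the function \<open>w'\<close> is constant, and
            monotonicity of \<open>U\<close> takes over.\<close>
          have w'_le': "w' \<tau> \<le> U \<tau>" if "r \<le> \<tau>" "\<tau> \<le> t" for \<tau>
            using f_pos[OF w'_ge, of \<tau> \<tau>] fw'[OF that] m by linarith
          have w'_le: "w' \<tau> \<le> U \<tau>" for \<tau>
          proof (cases "\<tau> \<le> r")
            case True
            then show ?thesis using S_le[OF w(1)] by (simp add: w'_def)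
          next
            case False
            show ?thesis
            proof (cases "\<tau> \<le> t")
              case True
              then show ?thesis using False w'_le' by simp
            next
              case False
              then show ?thesis using w'_t[of \<tau>] w'_le'[of t] rt(2) monoD[OF U_mono, of t \<tau>] by simp
            qed
          qed
          \<comment> \<open>The interval is cut at \<open>r\<close>. To the left the bound is that
            of \<open>w\<close>; to the right, either the interval meets the segment, where
            \<open>m < f\<close> forces \<open>m \<le> M\<close>, or \<open>w'\<close> does not
            change.\<close>
          have w'_slope: "w' y - w' x \<le> M * (y - x)"
            if xy: "x \<le> y" "\<forall>\<tau>\<in>{x..y}. f \<tau> (w' \<tau>) \<le> M" for x y M
          proof -
            have M: "0 \<le> M" using bspec[OF xy(2), of x] xy(1) f_bounds[OF w'_ge, of x x] by simp
            have left: "w' (min y r) - w' (min x r) \<le> M * (min y r - min x r)"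
            proof -
              have "w (min y r) - w (min x r) \<le> M * (min y r - min x r)"
              proof (cases "x \<le> r")
                case True
                show ?thesis
                proof (rule S_slope[OF w(1)])
                  fix \<tau> assume "min x r \<le> \<tau>" "\<tau> \<le> min y r"
                  then have "\<tau> \<in> {x..y}" "\<tau> \<le> r" using True by auto
                  then show "f \<tau> (w \<tau>) \<le> M" using xy(2) by (force simp: w'_def)
                qed (use xy in auto)
              qed (use xy in auto)
              then show ?thesis by (simp add: w'_def)
            qed
            have right: "w' (max y r) - w' (max x r) \<le> M * (max y r - max x r)"
            proof -
              have eq: "w' (max z r) = w r + m * (min (max z r) t - r)" for z
                using rt(2) by (auto simp: w'_def min_def max_def)
              show ?thesis
              proof (cases "max x r \<le> t \<and> r < y")
                case True
                then have "max x r \<in> {x..y}" using xy by auto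
                from bspec[OF xy(2) this] have "m \<le> M" using fw'[of "max x r"] True by simp
                have "m * (min (max y r) t - min (max x r) t) \<le> M * (max y r - max x r)"
                  using \<open>m \<le> M\<close> m xy(1) True by (intro mult_mono) auto
                then show ?thesis by (simp add: eq algebra_simps)
              next
                case False
                then have "min (max y r) t = min (max x r) t" using xy rt(2) by auto
                then show ?thesis using M xy(1) by (simp add: eq)
              qed
            qed
            \<comment> \<open>One of the two clamped points is \<open>r\<close> itself, which lets
              the left and right estimates be added without cases on the position of
              \<open>x\<close> and \<open>y\<close>.\<close>
            have split: "w' z = w' (min z r) + w' (max z r) - w' r" for z
              by (auto simp: min_def max_def)
            have "M * (y - x) = M * (min y r - min x r) + M * (max y r - max x r)"
              by (simp add: min_def max_def algebra_simps)
            then show ?thesis using left right split[of x] split[of y] by linarith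
          qed
          have "w' \<in> S"
            unfolding S_def using w'_mono w'_ge w'_le w'_slope by blast
          from W_upper[OF this, of t] have "w r + m * (t - r) \<le> W t"
            using w'_r[of t] rt(2) by simp
          then show "(f0 - e) * (t - r) \<le> W t - W r + \<eta>'"
            using w(2) unfolding m_def by linarith
        qed
      qed
      show ?thesis using \<eta>(1) up low by blast
    qed
    note est = this
    show ?thesis
      unfolding has_field_derivative_iff LIM_def
    proof (intro allI impI)
      fix e :: real assume "e > 0"
      then obtain \<eta> where \<eta>: "\<eta> > 0" and b: "\<And>r t. t0 - \<eta> < r \<Longrightarrow> r \<le> t \<Longrightarrow> t < t0 + \<eta> \<Longrightarrow>
        (f0 - e/2) * (t - r) \<le> W t - W r \<and> W t - W r \<le> (f0 + e/2) * (t - r)"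
        using est[of "e/2"] by (metis half_gt_zero)
      have "\<bar>(W y - W t0) / (y - t0) - f0\<bar> \<le> e / 2" if y: "y \<noteq> t0" "\<bar>y - t0\<bar> < \<eta>" for y
      proof (cases "t0 < y")
        case True
        then have "f0 - e/2 \<le> (W y - W t0) / (y - t0)" "(W y - W t0) / (y - t0) \<le> f0 + e/2"
          using b[of t0 y] y \<eta> by (simp_all add: pos_le_divide_eq pos_divide_le_eq)
        then show ?thesis by linarith
      next
        case False
        have "f0 - e/2 \<le> (W t0 - W y) / (t0 - y)" "(W t0 - W y) / (t0 - y) \<le> f0 + e/2"
          using b[of y t0] False y \<eta> by (simp_all add: pos_le_divide_eq pos_divide_le_eq)
        moreover have "(W y - W t0) / (y - t0) = (W t0 - W y) / (t0 - y)"
          by (metis minus_diff_eq minus_divide_divide)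
        ultimately show ?thesis by linarith
      qed
      then show "\<exists>s>0. \<forall>y. y \<noteq> t0 \<and> dist y t0 < s \<longrightarrow> dist ((W y - W t0) / (y - t0)) (f t0 (W t0)) < e"
        using \<eta> \<open>e > 0\<close> by (intro exI[of _ \<eta>]) (fastforce simp: dist_real_def f0_def)
    qed
  qed
  then show ?thesis using W_ge W_le by blast
qed

subsection \<open>The upper root of the potential\<close>

text \<open>A signed square root of \<open>V c s - (1 + |c|)^2\<close>: it vanishes at
  \<open>s_crit c\<close> and increases from there, which turns monotonicity of \<open>V\<close>
  into that of a square.\<close>

definition gap :: "real \<Rightarrow> real \<Rightarrow> real" where
  "gap c s = tan s - \<bar>c\<bar> / tan s"

lemma s_crit_nonneg: "0 \<le> s_crit c"
  by (simp add: s_crit_def)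

lemma s_crit_pos: "0 < s_crit c \<longleftrightarrow> c \<noteq> 0"
  by (simp add: s_crit_def)

lemma s_crit_less: "s_crit c < pi / 2"
  unfolding s_crit_def by (rule arctan_ubound)

lemma tan_s_crit: "tan (s_crit c) = sqrt \<bar>c\<bar>"
  by (simp add: s_crit_def tan_arctan)

lemma gap_s_crit: "gap c (s_crit c) = 0"
  by (simp add: gap_def tan_s_crit real_div_sqrt)

lemma gap_strict_mono:
  assumes "s_crit c \<le> s" "s < r" "r < pi / 2"
  shows "gap c s < gap c r"
proof -
  have t: "tan s < tan r"
    using assms s_crit_nonneg[of c] by (intro tan_monotone) auto
  show ?thesis
  proof (cases "c = 0")
    case False
    then have "0 < s" using assms(1) s_crit_pos[of c] by linarith
    then have "0 < tan s" using assms by (intro tan_gt_zero) auto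
    then have "\<bar>c\<bar> / tan r \<le> \<bar>c\<bar> / tan s"
      using t by (intro divide_left_mono) auto
    then show ?thesis using t by (simp add: gap_def)
  qed (simp add: gap_def t)
qed

lemma gap_nonneg:
  assumes "s_crit c \<le> s" "s < pi / 2"
  shows "0 \<le> gap c s"
  using gap_strict_mono[of c "s_crit c" s] gap_s_crit[of c] assms by (cases "s = s_crit c") auto

text \<open>The case \<open>s = 0\<close> occurs for \<open>c = 0\<close> only; there the junk values
  \<open>1 / sin 0 = 0\<close> and \<open>1 / tan 0 = 0\<close> give the intended continuous extension of \<open>V 0\<close>.\<close>
lemma V_eq_gap:
  assumes "s_crit c \<le> s" "s < pi / 2"
  shows "V c s = (1 + \<bar>c\<bar>)\<^sup>2 + (gap c s)\<^sup>2"
proof (cases "s = 0")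
  case True
  then have "c = 0" using assms(1) s_crit_pos[of c] s_crit_nonneg[of c] by auto
  then show ?thesis by (simp add: True V_def gap_def)
next
  case False
  then have "0 < s" using assms(1) s_crit_nonneg[of c] by linarith
  then show ?thesis unfolding gap_def by (rule V_eq_tan[OF _ assms(2)])
qed

lemma V_strict_mono:
  assumes "s_crit c \<le> s" "s < r" "r < pi / 2"
  shows "V c s < V c r"
  using V_eq_gap[of c s] V_eq_gap[of c r] gap_strict_mono[OF assms] gap_nonneg[of c s] assms
  by (simp add: power_strict_mono)

lemma V_inj:
  assumes "s_crit c \<le> s" "s < pi / 2" "s_crit c \<le> r" "r < pi / 2" "V c s = V c r"
  shows "s = r"
  using V_strict_mono[of c s r] V_strict_mono[of c r s] assms by linarith

lemma V_mono:
  assumes "s_crit c \<le> s" "s \<le> r" "r < pi / 2"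
  shows "V c s \<le> V c r"
  using V_strict_mono[of c s r] assms by (cases "s = r") auto

lemma V_s_crit: "V c (s_crit c) = (1 + \<bar>c\<bar>)\<^sup>2"
  using V_eq_gap[of c "s_crit c"] s_crit_less[of c] by (simp add: gap_s_crit)

lemma V_ge:
  assumes "0 < s" "s < pi / 2"
  shows "(1 + \<bar>c\<bar>)\<^sup>2 \<le> V c s"
  using V_eq_tan[OF assms, of c] by simp

text \<open>For \<open>c \<noteq> 0\<close> the bound forces \<open>s > 0\<close>, so the sine is
  positive. For \<open>c = 0\<close> the cosecant term is identically zero, which covers the end
  point \<open>s = 0\<close>.\<close>

lemma isCont_V:
  assumes "s_crit c \<le> s" "s < pi / 2"
  shows "isCont (V c) s"
proof -
  have "cos s > 0" using assms s_crit_nonneg[of c] by (intro cos_gt_zero_pi) auto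
  moreover have "c = 0 \<or> sin s > 0"
    using assms s_crit_pos[of c] by (cases "c = 0") (auto intro!: sin_gt_zero)
  ultimately show ?thesis
    unfolding V_def by (cases "c = 0") (auto intro!: continuous_intros)
qed

lemma V_has_derivative:
  assumes "0 < s" "s < pi / 2"
  shows "(V c has_real_derivative
    (2 * sin s * (1 / cos s) ^ 3 - 2 * c\<^sup>2 * cos s * (1 / sin s) ^ 3)) (at s)"
proof -
  have "cos s > 0" "sin s > 0"
    using assms by (auto intro: cos_gt_zero sin_gt_zero2)
  then show ?thesis
    unfolding V_def
    by (auto intro!: derivative_eq_intros simp: field_simps power2_eq_square power3_eq_cube)
qed

text \<open>An explicit form of the upper root as a function of the value \<open>y = F t\<close>:
  \<open>d\<close> is the required gap, and the argument of \<open>arctan\<close> is the nonnegative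
  solution of \<open>x^2 - d * x - |c| = 0\<close>, that is of \<open>x - |c| / x = d\<close> when
  \<open>x > 0\<close>. Continuity and limits of \<open>U\<close> can be read off from it.\<close>

definition U_root :: "real \<Rightarrow> real \<Rightarrow> real \<Rightarrow> real" where
  "U_root \<epsilon> c y = (let d = sqrt (y\<^sup>2 / \<epsilon> - (1 + \<bar>c\<bar>)\<^sup>2) in arctan ((d + sqrt (d\<^sup>2 + 4 * \<bar>c\<bar>)) / 2))"

lemma U_root_less: "U_root \<epsilon> c y < pi / 2"
  unfolding U_root_def Let_def by (rule arctan_ubound)

text \<open>The library function \<open>sqrt\<close> is continuous on the whole line, negative
  arguments included, and so is \<open>arctan\<close>.\<close>

lemma isCont_U_root:
  assumes "\<epsilon> > 0"
  shows "isCont (U_root \<epsilon> c) y"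
  unfolding U_root_def Let_def using assms by (intro continuous_intros) auto

text \<open>The tangent of the root is at least the gap \<open>d\<close>, and \<open>d\<close> tends
  to infinity with \<open>F\<close>.\<close>

lemma U_root_tendsto_pi_half:
  assumes F: "filterlim F at_top G" and \<epsilon>: "\<epsilon> > 0"
  shows "((\<lambda>t. U_root \<epsilon> c (F t)) \<longlongrightarrow> pi / 2) G"
proof -
  define d where "d t = sqrt ((F t)\<^sup>2 / \<epsilon> - (1 + \<bar>c\<bar>)\<^sup>2)" for t
  have "filterlim (\<lambda>t. (1 / \<epsilon>) * (F t)\<^sup>2) at_top G"
    using \<epsilon> by (intro filterlim_tendsto_pos_mult_at_top[OF tendsto_const] filterlim_pow_at_top[OF _ F]) auto
  then have "filterlim (\<lambda>t. - (1 + \<bar>c\<bar>)\<^sup>2 + (1 / \<epsilon>) * (F t)\<^sup>2) at_top G"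
    by (rule filterlim_tendsto_add_at_top[OF tendsto_const])
  then have "filterlim (\<lambda>t. (F t)\<^sup>2 / \<epsilon> - (1 + \<bar>c\<bar>)\<^sup>2) at_top G"
    by (simp add: algebra_simps)
  then have d: "filterlim d at_top G"
    unfolding d_def by (rule filterlim_compose[OF sqrt_at_top])
  have "d t \<le> (d t + sqrt ((d t)\<^sup>2 + 4 * \<bar>c\<bar>)) / 2" for t
  proof -
    have "d t \<le> sqrt ((d t)\<^sup>2 + 4 * \<bar>c\<bar>)" by (rule real_le_rsqrt) simp
    then show ?thesis by simp
  qed
  then have "filterlim (\<lambda>t. (d t + sqrt ((d t)\<^sup>2 + 4 * \<bar>c\<bar>)) / 2) at_top G"
    by (intro filterlim_at_top_mono[OF d] always_eventually) auto
  from filterlim_compose[OF tendsto_arctan_at_top this] show ?thesis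
    unfolding U_root_def Let_def d_def .
qed

lemma U_root_correct:
  assumes \<epsilon>: "\<epsilon> > 0" and y: "sqrt \<epsilon> * (1 + \<bar>c\<bar>) \<le> y"
  shows U_root_ge: "s_crit c \<le> U_root \<epsilon> c y"
    and V_U_root: "\<epsilon> * V c (U_root \<epsilon> c y) = y\<^sup>2"
proof -
  define d where "d = sqrt (y\<^sup>2 / \<epsilon> - (1 + \<bar>c\<bar>)\<^sup>2)"
  define x where "x = (d + sqrt (d\<^sup>2 + 4 * \<bar>c\<bar>)) / 2"
  have U: "U_root \<epsilon> c y = arctan x" by (simp add: U_root_def Let_def d_def x_def)
  have "(sqrt \<epsilon> * (1 + \<bar>c\<bar>))\<^sup>2 \<le> y\<^sup>2" using y \<epsilon> by (intro power_mono) auto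
  then have "(1 + \<bar>c\<bar>)\<^sup>2 \<le> y\<^sup>2 / \<epsilon>"
    using \<epsilon> by (simp add: power_mult_distrib pos_le_divide_eq mult.commute)
  then have d: "d\<^sup>2 = y\<^sup>2 / \<epsilon> - (1 + \<bar>c\<bar>)\<^sup>2" "d \<ge> 0" by (auto simp: d_def)
  have "sqrt (4 * \<bar>c\<bar>) \<le> sqrt (d\<^sup>2 + 4 * \<bar>c\<bar>)" by simp
  then have x: "sqrt \<bar>c\<bar> \<le> x" using d(2) by (simp add: x_def real_sqrt_mult)
  then show ge: "s_crit c \<le> U_root \<epsilon> c y" by (simp add: U s_crit_def arctan_le_iff)
  have "2 * x - d = sqrt (d\<^sup>2 + 4 * \<bar>c\<bar>)" by (simp add: x_def field_simps)
  then have "(2 * x - d)\<^sup>2 = d\<^sup>2 + 4 * \<bar>c\<bar>" by simp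
  then have q: "x * x - \<bar>c\<bar> = d * x" by (simp add: field_simps power2_eq_square)
  \<comment> \<open>A zero tangent occurs only for \<open>c = 0\<close> at the threshold; there the
    default value of division by zero makes the gap \<open>0\<close>, which is still
    \<open>d\<close>.\<close>
  have x0: "x = 0 \<Longrightarrow> c = 0 \<and> d = 0"
    using x d(2) by (simp add: x_def)
  have "gap c (arctan x) = d"
  proof (cases "x = 0")
    case False
    then show ?thesis using q by (simp add: gap_def tan_arctan field_simps)
  qed (use x0 in \<open>simp add: gap_def\<close>)
  then have "V c (U_root \<epsilon> c y) = y\<^sup>2 / \<epsilon>"
    using V_eq_gap[OF ge U_root_less] U d(1) by simp
  then show "\<epsilon> * V c (U_root \<epsilon> c y) = y\<^sup>2" using \<epsilon> by simp
qed

lemma U_root_unique: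
  assumes "\<epsilon> > 0" "sqrt \<epsilon> * (1 + \<bar>c\<bar>) \<le> y"
    and "s_crit c \<le> s" "s < pi / 2" "\<epsilon> * V c s = y\<^sup>2"
  shows "s = U_root \<epsilon> c y"
proof (rule V_inj[OF assms(3,4) U_root_ge[OF assms(1,2)] U_root_less])
  have "\<epsilon> * V c s = \<epsilon> * V c (U_root \<epsilon> c y)" using V_U_root[OF assms(1,2)] assms(5) by simp
  then show "V c s = V c (U_root \<epsilon> c y)" using assms(1) by simp
qed

lemma U_root_mono:
  assumes "\<epsilon> > 0" "sqrt \<epsilon> * (1 + \<bar>c\<bar>) \<le> x" "x \<le> y"
  shows "U_root \<epsilon> c x \<le> U_root \<epsilon> c y"
proof (rule ccontr)
  assume "\<not> ?thesis"
  moreover have y: "sqrt \<epsilon> * (1 + \<bar>c\<bar>) \<le> y" using assms by simp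
  ultimately have "V c (U_root \<epsilon> c y) < V c (U_root \<epsilon> c x)"
    using assms by (intro V_strict_mono U_root_ge U_root_less) auto
  then have "\<epsilon> * V c (U_root \<epsilon> c y) < \<epsilon> * V c (U_root \<epsilon> c x)" using assms(1) by simp
  then have "y\<^sup>2 < x\<^sup>2" using V_U_root[OF assms(1) y] V_U_root[OF assms(1,2)] by simp
  moreover have "0 \<le> x" using assms(1,2) by (smt (verit) mult_nonneg_nonneg real_sqrt_ge_zero)
  ultimately show False using assms(3) by (smt (verit) power_mono)
qed

lemma upper_root_eq_U_root:
  assumes \<epsilon>: "\<epsilon> > 0" and F: "sqrt \<epsilon> * (1 + \<bar>c\<bar>) < F t"
  shows "upper_root F \<epsilon> c t = U_root \<epsilon> c (F t)"
proof (cases "c = 0")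
  case True
  have "0 < sqrt \<epsilon>" "sqrt \<epsilon> < F t" using F \<epsilon> True by auto
  moreover from this have "0 < F t" by (rule less_trans)
  ultimately have p: "0 < sqrt \<epsilon> / F t" "sqrt \<epsilon> / F t < 1" "0 < F t" by auto
  define s where "s = arccos (sqrt \<epsilon> / F t)"
  have c: "cos s = sqrt \<epsilon> / F t" using p by (simp add: s_def)
  have "0 \<le> s" using p by (simp add: s_def arccos_lbound)
  moreover have "s < pi / 2"
    using p arccos_less_arccos[of 0 "sqrt \<epsilon> / F t"] by (simp add: s_def)
  moreover have "\<epsilon> * V 0 s = (F t)\<^sup>2" using p \<epsilon> by (simp add: V_def c power_divide)
  ultimately have "s = U_root \<epsilon> 0 (F t)"
    using F True \<epsilon> by (intro U_root_unique) auto
  then show ?thesis by (simp add: upper_root_def True s_def)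
next
  case False
  \<comment> \<open>A root at the minimum of \<open>V\<close> would make \<open>F t\<close> equal to
    the threshold value, while \<open>F t\<close> lies strictly above it. The definite description
    asks for a root strictly beyond \<open>s_crit c\<close>.\<close>
  have "s_crit c \<noteq> U_root \<epsilon> c (F t)"
  proof
    assume "s_crit c = U_root \<epsilon> c (F t)"
    then have "\<epsilon> * (1 + \<bar>c\<bar>)\<^sup>2 = (F t)\<^sup>2"
      using V_U_root[OF \<epsilon>, of c "F t"] F V_s_crit[of c] by simp
    moreover have "(sqrt \<epsilon> * (1 + \<bar>c\<bar>))\<^sup>2 < (F t)\<^sup>2"
      using F \<epsilon> by (intro power_strict_mono) auto
    ultimately show False using \<epsilon> by (simp add: power_mult_distrib)
  qed
  then have "(THE s. s_crit c < s \<and> s < pi / 2 \<and> \<epsilon> * V c s = (F t)\<^sup>2) = U_root \<epsilon> c (F t)"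
    using U_root_ge[OF \<epsilon>, of c "F t"] V_U_root[OF \<epsilon>, of c "F t"] U_root_less F
    by (intro the1_equality ex1_upper_root[OF False \<epsilon> F]) (auto simp: less_le)
  then show ?thesis by (simp add: upper_root_def False)
qed

subsection \<open>Limits of monotone functions and of their derivatives\<close>

lemma mono_tendsto_SUP_at_top:
  fixes f :: "real \<Rightarrow> real"
  assumes "mono f" "bdd_above (range f)"
  shows "(f \<longlongrightarrow> (SUP t. f t)) at_top"
proof (rule order_tendstoI)
  fix a assume "a < (SUP t. f t)"
  then obtain t where "a < f t" using assms(2) by (auto simp: less_cSUP_iff)
  then show "\<forall>\<^sub>F x in at_top. a < f x"
    by (intro eventually_mono[OF eventually_ge_at_top[of t]]) (use assms(1) in \<open>auto dest: monoD intro: less_le_trans\<close>)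
next
  fix a assume "(SUP t. f t) < a"
  then show "\<forall>\<^sub>F x in at_top. f x < a"
    using cSUP_upper[OF _ assms(2)] by (intro always_eventually) (auto intro: le_less_trans)
qed

lemma mono_tendsto_INF_at_bot:
  fixes f :: "real \<Rightarrow> real"
  assumes "mono f" "bdd_below (range f)"
  shows "(f \<longlongrightarrow> (INF t. f t)) at_bot"
proof (rule order_tendstoI)
  fix a assume "(INF t. f t) < a"
  then obtain t where "f t < a" using assms(2) by (auto simp: cINF_less_iff)
  then show "\<forall>\<^sub>F x in at_bot. f x < a"
    by (intro eventually_mono[OF eventually_le_at_bot[of t]]) (use assms(1) in \<open>auto dest: monoD intro: le_less_trans\<close>)
next
  fix a assume "a < (INF t. f t)"
  then show "\<forall>\<^sub>F x in at_bot. a < f x"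
    using cINF_lower[OF assms(2)] by (intro always_eventually) (auto intro: less_le_trans)
qed

lemma mono_unbounded_at_top:
  fixes f :: "real \<Rightarrow> real"
  assumes "mono f" "\<not> bdd_above (range f)"
  shows "filterlim f at_top at_top"
  unfolding filterlim_at_top
proof
  fix Z
  obtain t where "Z < f t" using assms(2) by (fastforce simp: bdd_above_def not_le)
  then show "\<forall>\<^sub>F x in at_top. Z \<le> f x"
    by (intro eventually_mono[OF eventually_ge_at_top[of t]]) (use assms(1) in \<open>fastforce dest: monoD\<close>)
qed

text \<open>By the mean value theorem the increment over \<open>[t, t + 1]\<close> is a value of
  \<open>s'\<close> at a point tending to infinity. It tends to \<open>q\<close>, and also to
  \<open>l - l\<close>.\<close>

lemma deriv_limit_zero_at_top:
  fixes s s' :: "real \<Rightarrow> real"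
  assumes D: "\<And>t. (s has_real_derivative s' t) (at t)"
    and s: "(s \<longlongrightarrow> l) at_top" and s': "(s' \<longlongrightarrow> q) at_top"
  shows "q = 0"
proof -
  have "\<exists>z>t. s (t + 1) - s t = s' z" for t
    using MVT2[of t "t + 1" s s'] D by auto
  then obtain z where z: "\<And>t. t < z t" "\<And>t. s (t + 1) - s t = s' (z t)" by metis
  have "filterlim z at_top at_top"
    by (rule filterlim_at_top_mono[OF filterlim_ident]) (use z(1) in \<open>auto simp: less_imp_le\<close>)
  from filterlim_compose[OF s' this] have "((\<lambda>t. s (t + 1) - s t) \<longlongrightarrow> q) at_top"
    by (simp add: z(2))
  moreover have "filterlim (\<lambda>t::real. t + 1) at_top at_top"
    by (rule filterlim_at_top_mono[OF filterlim_ident]) auto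
  from tendsto_diff[OF filterlim_compose[OF s this] s]
  have "((\<lambda>t. s (t + 1) - s t) \<longlongrightarrow> 0) at_top" by simp
  ultimately show ?thesis by (rule tendsto_unique[OF trivial_limit_at_top_linorder])
qed

text \<open>Time reversal reduces this to the limit at \<open>+\<infinity>\<close>.\<close>

lemma deriv_limit_zero_at_bot:
  fixes s s' :: "real \<Rightarrow> real"
  assumes D: "\<And>t. (s has_real_derivative s' t) (at t)"
    and s: "(s \<longlongrightarrow> l) at_bot" and s': "(s' \<longlongrightarrow> q) at_bot"
  shows "q = 0"
proof -
  have "((\<lambda>t. s (- t)) has_real_derivative - s' (- t)) (at t)" for t
    using DERIV_chain2[OF D DERIV_minus[OF DERIV_ident], of t] by simp
  moreover have "((\<lambda>t. s (- t)) \<longlongrightarrow> l) at_top" "((\<lambda>t. - s' (- t)) \<longlongrightarrow> - q) at_top"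
    using s s' by (auto simp: filterlim_at_bot_mirror intro: tendsto_minus)
  ultimately have "- q = 0" by (rule deriv_limit_zero_at_top)
  then show ?thesis by simp
qed

subsection \<open>The upper branch\<close>

text \<open>The setting is kept free of \<open>c \<noteq> 0\<close> so that it covers
  \<open>c = 0\<close>, and it is instantiated again at \<open>\<epsilon> * c\<^sup>2\<close> and
  \<open>1 / c\<close> for the lower branch. Strictness of \<open>Fminus < F t\<close> keeps
  \<open>F\<close> above the threshold even in the equality case.\<close>

locale admissible_profile =
  fixes F :: "real \<Rightarrow> real" and \<epsilon> c Fminus :: real
  assumes F_smooth: "smooth_real F"
    and F_deriv: "\<And>t. deriv F t > 0"
    and Fminus_lim: "(F \<longlongrightarrow> Fminus) at_bot"
    and Fminus_less: "\<And>t. Fminus < F t"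
    and eps_pos: "\<epsilon> > 0"
    and threshold: "sqrt \<epsilon> * (1 + \<bar>c\<bar>) \<le> Fminus"
begin

abbreviation U :: "real \<Rightarrow> real" where
  "U t \<equiv> U_root \<epsilon> c (F t)"

abbreviation G :: "real \<Rightarrow> real \<Rightarrow> real" where
  "G t s \<equiv> 1 - \<epsilon> * V c s / (F t)\<^sup>2"

lemma F_DERIV: "(F has_real_derivative deriv F t) (at t)"
  by (rule smooth_real_DERIV[OF F_smooth])

lemma isCont_F: "isCont F t"
  using F_DERIV by (rule DERIV_isCont)

lemma F_mono: "mono F"
proof (rule monoI)
  fix x y :: real assume "x \<le> y"
  then show "F x \<le> F y"
    by (rule DERIV_nonneg_imp_nondecreasing) (use F_DERIV F_deriv in \<open>blast intro: less_imp_le\<close>)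
qed

lemma F_greater: "sqrt \<epsilon> * (1 + \<bar>c\<bar>) < F t"
  using threshold Fminus_less[of t] by linarith

lemma Fminus_pos: "Fminus > 0"
proof -
  have "0 < sqrt \<epsilon> * (1 + \<bar>c\<bar>)" using eps_pos by (intro mult_pos_pos) auto
  then show ?thesis using threshold by linarith
qed

lemma F_pos: "F t > 0"
  using Fminus_pos Fminus_less[of t] by linarith

lemma U_ge: "s_crit c \<le> U t"
  by (rule U_root_ge[OF eps_pos less_imp_le[OF F_greater]])

lemma V_U: "\<epsilon> * V c (U t) = (F t)\<^sup>2"
  by (rule V_U_root[OF eps_pos less_imp_le[OF F_greater]])

lemma U_mono: "mono U"
  using F_mono F_greater by (intro monoI U_root_mono[OF eps_pos]) (auto dest: monoD intro: less_imp_le)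

lemma upper_root_eq: "upper_root F \<epsilon> c = U"
  by (intro ext upper_root_eq_U_root eps_pos F_greater)

lemma G_s_crit_pos: "0 < G t (s_crit c)"
proof -
  have "(sqrt \<epsilon> * (1 + \<bar>c\<bar>))\<^sup>2 < (F t)\<^sup>2"
    using F_greater eps_pos by (intro power_strict_mono) auto
  then show ?thesis using eps_pos F_pos[of t] by (simp add: V_s_crit power_mult_distrib)
qed

lemma G_nonneg: "0 \<le> G t s" if "s_crit c \<le> s" "s \<le> U t"
proof -
  have "\<epsilon> * V c s \<le> (F t)\<^sup>2"
    using V_mono[OF that U_root_less] eps_pos V_U[of t] by (metis less_imp_le mult_left_mono)
  then show ?thesis using F_pos[of t] by simp
qed

lemma less_U_if_G_pos:
  assumes "s_crit c \<le> s" "s \<le> U t" "0 < G t s"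
  shows "s < U t"
  using assms V_U[of t] F_pos[of t] by (cases "s = U t") auto

text \<open>The function \<open>v\<close> stands for \<open>V c\<close> along a curve. The result
  serves both the contact argument at \<open>U\<close>, where \<open>v' = 0\<close>, and the
  smoothness proof.\<close>

lemma G_DERIV:
  assumes "(v has_real_derivative v') (at t)"
  shows "((\<lambda>t. 1 - \<epsilon> * v t / (F t)\<^sup>2) has_real_derivative
    - \<epsilon> * v' * (1 / F t) ^ 2 + 2 * \<epsilon> * v t * deriv F t * (1 / F t) ^ 3) (at t)"
  using F_pos[of t]
  by (auto intro!: derivative_eq_intros assms F_DERIV simp: field_simps power2_eq_square power3_eq_cube)

section \<open>Existence of the upper branch\<close>

lemma closed_solution_exists:
  "\<exists>W. \<forall>t. s_crit c \<le> W t \<and> W t \<le> U t \<and> (W has_real_derivative sqrt (G t (W t))) (at t)"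
proof -
  \<comment> \<open>Clamping \<open>y\<close> at \<open>U t\<close> extends the right-hand side by
    zero above \<open>U\<close>, where \<open>G\<close> would be negative. The extension is
    continuous and positive only below \<open>U\<close>.\<close>
  define f where "f t y = sqrt (G t (min y (U t)))" for t y
  have "\<exists>W. \<forall>t. s_crit c \<le> W t \<and> W t \<le> U t \<and> (W has_real_derivative f t (W t)) (at t)"
  proof (rule perron_entire_solution[OF U_ge U_mono])
    fix t y assume y: "s_crit c \<le> y"
    have *: "s_crit c \<le> min y (U t)" "min y (U t) \<le> U t" "min y (U t) < pi / 2"
      using y U_ge[of t] U_root_less[of \<epsilon> c "F t"] by auto
    have "0 \<le> V c (min y (U t))"
      unfolding V_eq_gap[OF *(1,3)] by simp
    then show "0 \<le> f t y \<and> f t y \<le> 1"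
      using G_nonneg[OF *(1,2)] eps_pos by (simp add: f_def)
    show "y \<le> U t" if "0 < f t y"
    proof (rule ccontr)
      assume "\<not> ?thesis"
      then have "f t y = 0" using V_U[of t] F_pos[of t] by (simp add: f_def)
      then show False using that by simp
    qed
    show "isCont (\<lambda>p. f (fst p) (snd p)) (t, y)"
    proof -
      have F: "isCont (\<lambda>p. F (fst p)) (t, y)"
        by (rule isCont_o2[OF _ isCont_F]) (simp add: isCont_fst)
      have "isCont (\<lambda>p. min (snd p) (U (fst p))) (t, y)"
        by (intro continuous_min isCont_snd continuous_ident isCont_o2[OF F isCont_U_root[OF eps_pos]])
      then have "isCont (\<lambda>p. V c (min (snd p) (U (fst p)))) (t, y)"
        by (rule isCont_o2) (use isCont_V * in simp)
      then show ?thesis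
        unfolding f_def using F F_pos[of t] by (auto intro!: continuous_intros simp: less_imp_neq[THEN not_sym])
    qed
  qed
  then obtain W where "\<And>t. s_crit c \<le> W t \<and> W t \<le> U t \<and> (W has_real_derivative f t (W t)) (at t)" by blast
  moreover from this have "f t (W t) = sqrt (G t (W t))" for t by (simp add: f_def min_absorb1)
  ultimately show ?thesis by (intro exI[of _ W]) auto
qed

text \<open>Contact with either boundary of the strip is contradicted just before the contact time.
  Strict positivity of \<open>G\<close> is what makes the square root differentiable along
  \<open>W\<close>.\<close>

lemma closed_solution_interior:
  assumes W: "\<And>t. s_crit c \<le> W t" "\<And>t. W t \<le> U t"
    and D: "\<And>t. (W has_real_derivative sqrt (G t (W t))) (at t)"
  shows "s_crit c < W t" "0 < G t (W t)"
proof -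
  have gt: "s_crit c < W t" for t
  proof (rule ccontr)
    assume "\<not> ?thesis"
    then have "W t = s_crit c" using W(1)[of t] by linarith
    then have "0 < sqrt (G t (W t))" using G_s_crit_pos by simp
    from DERIV_pos_inc_left[OF D this] obtain d where "d > 0" "\<And>h. h > 0 \<Longrightarrow> h < d \<Longrightarrow> W (t - h) < W t"
      by blast
    then have "W (t - d / 2) < s_crit c" using \<open>W t = s_crit c\<close> by fastforce
    then show False using W(1)[of "t - d / 2"] by linarith
  qed
  then show "s_crit c < W t" .
  have W0: "0 < W t" "W t < pi / 2" for t
    using gt[of t] s_crit_nonneg[of c] W(2)[of t] U_root_less[of \<epsilon> c "F t"] by linarith+
  show "0 < G t (W t)"
  proof (rule ccontr)
    assume "\<not> ?thesis"
    then have G0: "G t (W t) = 0" using G_nonneg[OF W, of t] by linarith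
    then have W': "(W has_real_derivative 0) (at t)" using D[of t] unfolding G0 by simp
    have "\<epsilon> * V c (W t) = (F t)\<^sup>2" using G0 F_pos[of t] by simp
    then have V0: "0 < \<epsilon> * V c (W t)" by (metis F_pos zero_less_power)
    \<comment> \<open>At the contact time the slope of \<open>W\<close> is zero, so \<open>V\<close>
      along \<open>W\<close> is stationary and only the growth of \<open>F\<close> contributes to
      the derivative of \<open>G\<close>.\<close>
    have "((\<lambda>t. V c (W t)) has_real_derivative 0) (at t)"
      using DERIV_chain2[OF V_has_derivative[OF W0] W'] by simp
    from G_DERIV[OF this]
    have "((\<lambda>t. G t (W t)) has_real_derivative 2 * (\<epsilon> * V c (W t)) * deriv F t * (1 / F t) ^ 3) (at t)"
      by (simp add: mult.assoc)
    moreover have "0 < 2 * (\<epsilon> * V c (W t)) * deriv F t * (1 / F t) ^ 3"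
      by (rule mult_pos_pos[OF mult_pos_pos[OF mult_pos_pos[OF _ V0] F_deriv]]) (simp_all add: F_pos)
    ultimately obtain d where "d > 0" "\<And>h. h > 0 \<Longrightarrow> h < d \<Longrightarrow> G (t - h) (W (t - h)) < G t (W t)"
      using DERIV_pos_inc_left by blast
    then have "G (t - d / 2) (W (t - d / 2)) < 0" using G0 by fastforce
    then show False using G_nonneg[OF W, of "t - d / 2"] by linarith
  qed
qed

lemma interior_solution_smooth:
  assumes W0: "\<And>t. 0 < W t" "\<And>t. W t < pi / 2" and G: "\<And>t. 0 < G t (W t)"
    and D: "\<And>t. (W has_real_derivative sqrt (G t (W t))) (at t)"
  shows "smooth_real W"
proof -
  define p where "p t = sqrt (G t (W t))" for t
  have p: "p t > 0" for t using G by (simp add: p_def)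
  have cs: "cos (W t) > 0" "sin (W t) > 0" for t
    using W0 by (auto intro: cos_gt_zero sin_gt_zero2)
  define ip iF S C iS iC where "ip t = 1 / p t" and "iF t = 1 / F t" and "S t = sin (W t)"
    and "C t = cos (W t)" and "iS t = 1 / S t" and "iC t = 1 / C t" for t
  \<comment> \<open>These generators are chosen so that each derivative is a polynomial in them:
    \<open>p\<close> is the slope of \<open>W\<close>, and the reciprocals absorb every
    division.\<close>
  define B where "B = range (\<lambda>n. (deriv ^^ n) F) \<union> {W, p, ip, iF, S, C, iS, iC}"
  have mF: "(deriv ^^ n) F \<in> func_algebra B" for n
    by (intro func_algebra.base) (auto simp: B_def)
  have mB: "W \<in> func_algebra B" "p \<in> func_algebra B" "ip \<in> func_algebra B" "iF \<in> func_algebra B"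
    "S \<in> func_algebra B" "C \<in> func_algebra B" "iS \<in> func_algebra B" "iC \<in> func_algebra B"
    by (auto intro: func_algebra.base simp: B_def)
  have mF': "deriv F \<in> func_algebra B" using mF[of 1] by simp
  \<comment> \<open>This is the derivative of \<open>G\<close> along \<open>W\<close> divided by
    \<open>2 * p\<close>. Its first term carries the factor \<open>W' = p\<close>, which cancels, so
    only the second term needs \<open>ip\<close>.\<close>
  define p' where "p' t = (- \<epsilon> / 2) * ((2 * S t * iC t ^ 3 + (- 2 * c\<^sup>2) * C t * iS t ^ 3) * iF t ^ 2)
    + \<epsilon> * ((iC t ^ 2 + c\<^sup>2 * iS t ^ 2) * deriv F t * iF t ^ 3 * ip t)" for t
  have dW: "(W has_real_derivative p t) (at t)" for t using D by (simp add: p_def)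
  have dp: "(p has_real_derivative p' t) (at t)" for t
  proof -
    define V' where "V' = 2 * S t * iC t ^ 3 - 2 * c\<^sup>2 * C t * iS t ^ 3"
    have "((\<lambda>t. V c (W t)) has_real_derivative V' * p t) (at t)"
      using DERIV_chain2[OF V_has_derivative[OF W0] dW] by (simp add: V'_def S_def C_def iS_def iC_def)
    from G_DERIV[OF this] have "((\<lambda>t. G t (W t)) has_real_derivative
        - \<epsilon> * V' * p t * iF t ^ 2 + 2 * \<epsilon> * V c (W t) * deriv F t * iF t ^ 3) (at t)"
      by (simp add: iF_def mult.assoc)
    from DERIV_chain2[OF DERIV_real_sqrt[OF G] this]
    have "(p has_real_derivative (inverse (p t) / 2) *
      (- \<epsilon> * V' * p t * iF t ^ 2 + 2 * \<epsilon> * V c (W t) * deriv F t * iF t ^ 3)) (at t)"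
      unfolding p_def[symmetric] p_def[abs_def, symmetric] .
    moreover have "V c (W t) = iC t ^ 2 + c\<^sup>2 * iS t ^ 2"
      by (simp add: V_def iC_def iS_def C_def S_def power_divide)
    then have "(inverse (p t) / 2) *
      (- \<epsilon> * V' * p t * iF t ^ 2 + 2 * \<epsilon> * V c (W t) * deriv F t * iF t ^ 3) = p' t"
      using p[of t] by (simp add: p'_def V'_def ip_def field_simps)
    ultimately show ?thesis by simp
  qed
  have dS: "(S has_real_derivative C t * p t) (at t)" for t
    unfolding S_def C_def using DERIV_chain2[OF DERIV_sin dW] .
  \<comment> \<open>Signs are written as the constant factor \<open>- 1\<close>, so that the closure
    rules of the algebra apply to the term as it stands.\<close>
  have dC: "(C has_real_derivative (- 1) * (S t * p t)) (at t)" for t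
    unfolding S_def C_def using DERIV_chain2[OF DERIV_cos dW, of t] by simp
  have recip: "((\<lambda>t. 1 / h t) has_real_derivative (- 1) * (h' * (1 / h t) ^ 2)) (at t)"
    if "(h has_real_derivative h') (at t)" "h t > 0" for h h' t
    using that by (auto intro!: derivative_eq_intros simp: field_simps power2_eq_square)
  have dip: "(ip has_real_derivative (- 1) * (p' t * ip t ^ 2)) (at t)" for t
    unfolding ip_def by (rule recip[OF dp p])
  have diF: "(iF has_real_derivative (- 1) * (deriv F t * iF t ^ 2)) (at t)" for t
    unfolding iF_def by (rule recip[OF F_DERIV F_pos])
  have diS: "(iS has_real_derivative (- 1) * ((C t * p t) * iS t ^ 2)) (at t)" for t
    unfolding iS_def by (rule recip[OF dS]) (simp add: S_def cs)
  have diC: "(iC has_real_derivative (- 1) * (((- 1) * (S t * p t)) * iC t ^ 2)) (at t)" for t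
    unfolding iC_def by (rule recip[OF dC]) (simp add: C_def cs)
  have mp': "p' \<in> func_algebra B"
    unfolding p'_def[abs_def] by (intro func_algebra_closed mB mF')
  show ?thesis
  proof (rule smooth_real_func_algebra[OF _ mB(1)])
    fix b assume "b \<in> B"
    then consider n where "b = (deriv ^^ n) F" | "b = W" | "b = p" | "b = ip" | "b = iF"
      | "b = S" | "b = C" | "b = iS" | "b = iC"
      by (auto simp: B_def)
    then show "\<exists>b'\<in>func_algebra B. \<forall>t. (b has_real_derivative b' t) (at t)"
    proof cases
      case 1
      then show ?thesis using smooth_real_DERIV_funpow[OF F_smooth] mF by blast
    next
      case 2
      then show ?thesis using dW mB(2) by blast
    next
      case 3
      then show ?thesis using dp mp' by blast
    next
      case 4
      have "(\<lambda>t. (- 1) * (p' t * ip t ^ 2)) \<in> func_algebra B" by (intro func_algebra_closed mB mp')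
      with dip show ?thesis unfolding 4 by (intro bexI[rotated] allI)
    next
      case 5
      have "(\<lambda>t. (- 1) * (deriv F t * iF t ^ 2)) \<in> func_algebra B" by (intro func_algebra_closed mB mF')
      with diF show ?thesis unfolding 5 by (intro bexI[rotated] allI)
    next
      case 6
      have "(\<lambda>t. C t * p t) \<in> func_algebra B" by (intro func_algebra_closed mB)
      with dS show ?thesis unfolding 6 by (intro bexI[rotated] allI)
    next
      case 7
      have "(\<lambda>t. (- 1) * (S t * p t)) \<in> func_algebra B" by (intro func_algebra_closed mB)
      with dC show ?thesis unfolding 7 by (intro bexI[rotated] allI)
    next
      case 8
      have "(\<lambda>t. (- 1) * ((C t * p t) * iS t ^ 2)) \<in> func_algebra B" by (intro func_algebra_closed mB)
      with diS show ?thesis unfolding 8 by (intro bexI[rotated] allI)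
    next
      case 9
      have "(\<lambda>t. (- 1) * (((- 1) * (S t * p t)) * iC t ^ 2)) \<in> func_algebra B" by (intro func_algebra_closed mB)
      with diC show ?thesis unfolding 9 by (intro bexI[rotated] allI)
    qed
  qed
qed

lemma upper_branch_exists: "\<exists>s. upper_branch F \<epsilon> c s"
proof -
  obtain W where W: "\<And>t. s_crit c \<le> W t" "\<And>t. W t \<le> U t"
    and D: "\<And>t. (W has_real_derivative sqrt (G t (W t))) (at t)"
    using closed_solution_exists by blast
  note int = closed_solution_interior[OF W D]
  have W0: "0 < W t" "W t < pi / 2" for t
    using int(1)[of t] s_crit_nonneg[of c] W(2)[of t] U_root_less[of \<epsilon> c "F t"] by linarith+
  have "deriv W t = sqrt (G t (W t))" for t using D by (rule DERIV_imp_deriv)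
  moreover have "smooth_real W" by (rule interior_solution_smooth[OF W0 int(2) D])
  ultimately have "entire_solution F \<epsilon> c W"
    using W0 int(2) by (simp add: entire_solution_def less_imp_le)
  moreover have "W t < U t" for t by (rule less_U_if_G_pos[OF W int(2)])
  ultimately show ?thesis
    using int \<open>\<And>t. deriv W t = _\<close> unfolding upper_branch_def upper_root_eq by auto
qed

section \<open>Limits of an arbitrary upper branch\<close>

context
  fixes s :: "real \<Rightarrow> real"
  assumes s: "upper_branch F \<epsilon> c s"
begin

lemma upper_branch_bounds: "s_crit c < s t" "s t < U t" "s t < pi / 2"
  using s by (auto simp: upper_branch_def upper_root_eq entire_solution_def)

text \<open>The positive sign of the derivative selects the positive root of the squared
  equation.\<close>

lemma upper_branch_DERIV: "(s has_real_derivative sqrt (G t (s t))) (at t)"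
proof -
  have "deriv s t > 0" "(deriv s t)\<^sup>2 = G t (s t)" "smooth_real s"
    using s by (auto simp: upper_branch_def entire_solution_def)
  then show ?thesis using smooth_real_DERIV[of s t] by (metis less_imp_le real_sqrt_unique)
qed

lemma upper_branch_mono: "mono s"
proof (rule monoI)
  fix x y :: real assume "x \<le> y"
  then show "s x \<le> s y"
    by (rule DERIV_nonneg_imp_nondecreasing)
       (use upper_branch_DERIV G_nonneg upper_branch_bounds in \<open>meson less_imp_le real_sqrt_ge_zero\<close>)
qed

text \<open>The limit \<open>\<phi>\<close> of \<open>1 / (F t)\<^sup>2\<close> is a parameter, so
  that finite limits of \<open>F\<close> and, with \<open>\<phi> = 0\<close>, an infinite one are
  treated alike.\<close>

lemma upper_branch_rhs_tendsto:
  assumes "(s \<longlongrightarrow> l) H" "s_crit c \<le> l" "l < pi / 2" "((\<lambda>t. 1 / (F t)\<^sup>2) \<longlongrightarrow> \<phi>) H"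
  shows "((\<lambda>t. sqrt (G t (s t))) \<longlongrightarrow> sqrt (1 - \<epsilon> * V c l * \<phi>)) H"
proof -
  have "((\<lambda>t. V c (s t)) \<longlongrightarrow> V c l) H"
    using assms by (intro isCont_tendsto_compose[OF isCont_V])
  then have "((\<lambda>t. sqrt (1 - \<epsilon> * V c (s t) * (1 / (F t)\<^sup>2))) \<longlongrightarrow> sqrt (1 - \<epsilon> * V c l * \<phi>)) H"
    using assms(4) by (intro tendsto_intros)
  then show ?thesis by simp
qed

lemma upper_branch_at_bot: "(s \<longlongrightarrow> U_root \<epsilon> c Fminus) at_bot"
proof -
  have bdd: "bdd_below (range s)" using upper_branch_bounds(1) by (auto intro!: bdd_belowI2 less_imp_le)
  define l where "l = (INF t. s t)"
  have lim: "(s \<longlongrightarrow> l) at_bot"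
    unfolding l_def by (rule mono_tendsto_INF_at_bot[OF upper_branch_mono bdd])
  have l: "s_crit c \<le> l" "l < pi / 2"
    unfolding l_def using upper_branch_bounds(1) upper_branch_bounds(3)[of 0] cINF_lower[OF bdd, of 0]
    by (auto intro!: cINF_greatest intro: less_imp_le)
  have "((\<lambda>t. 1 / (F t)\<^sup>2) \<longlongrightarrow> 1 / Fminus\<^sup>2) at_bot"
    using Fminus_lim Fminus_pos by (auto intro!: tendsto_intros)
  from deriv_limit_zero_at_bot[OF upper_branch_DERIV lim upper_branch_rhs_tendsto[OF lim l this]]
  have "\<epsilon> * V c l = Fminus\<^sup>2" using Fminus_pos by simp
  then show ?thesis using U_root_unique[OF eps_pos threshold l] lim by simp
qed

lemma upper_branch_at_top_bounded:
  assumes F: "(F \<longlongrightarrow> Fplus) at_top"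
  shows "(s \<longlongrightarrow> U_root \<epsilon> c Fplus) at_top"
proof -
  have le: "F t \<le> Fplus" for t
    by (rule tendsto_lowerbound[OF F])
       (use F_mono in \<open>auto intro: eventually_mono[OF eventually_ge_at_top[of t]] dest: monoD\<close>)
  have Fplus: "sqrt \<epsilon> * (1 + \<bar>c\<bar>) \<le> Fplus" "0 < Fplus"
    using F_greater[of 0] F_pos[of 0] le[of 0] by linarith+
  \<comment> \<open>The root for \<open>Fplus\<close> is a uniform bound below
    \<open>pi / 2\<close>, which keeps the limit away from the singularity of
    \<open>V\<close>.\<close>
  have s_le: "s t \<le> U_root \<epsilon> c Fplus" for t
    using upper_branch_bounds(2)[of t] U_root_mono[OF eps_pos less_imp_le[OF F_greater] le, of t] by linarith
  have bdd: "bdd_above (range s)" using s_le by (auto intro!: bdd_aboveI2)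
  define l where "l = (SUP t. s t)"
  have lim: "(s \<longlongrightarrow> l) at_top"
    unfolding l_def by (rule mono_tendsto_SUP_at_top[OF upper_branch_mono bdd])
  have "l \<le> U_root \<epsilon> c Fplus" unfolding l_def using s_le by (intro cSUP_least) auto
  moreover have "s 0 \<le> l" unfolding l_def using bdd by (intro cSUP_upper) auto
  ultimately have l: "s_crit c \<le> l" "l < pi / 2"
    using upper_branch_bounds(1)[of 0] U_root_less[of \<epsilon> c Fplus] by linarith+
  have "((\<lambda>t. 1 / (F t)\<^sup>2) \<longlongrightarrow> 1 / Fplus\<^sup>2) at_top"
    using F Fplus by (auto intro!: tendsto_intros)
  from deriv_limit_zero_at_top[OF upper_branch_DERIV lim upper_branch_rhs_tendsto[OF lim l this]]
  have "\<epsilon> * V c l = Fplus\<^sup>2" using Fplus by simp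
  then show ?thesis using U_root_unique[OF eps_pos Fplus(1) l] lim by simp
qed

lemma upper_branch_at_top_unbounded:
  assumes F: "filterlim F at_top at_top"
  shows "(s \<longlongrightarrow> pi / 2) at_top"
proof -
  have bdd: "bdd_above (range s)" using upper_branch_bounds(3) by (intro bdd_aboveI2[of _ _ "pi / 2"] less_imp_le)
  define l where "l = (SUP t. s t)"
  have lim: "(s \<longlongrightarrow> l) at_top"
    unfolding l_def by (rule mono_tendsto_SUP_at_top[OF upper_branch_mono bdd])
  have "s 0 \<le> l" unfolding l_def using bdd by (intro cSUP_upper) auto
  then have l: "s_crit c \<le> l" using upper_branch_bounds(1)[of 0] by linarith
  have "l \<le> pi / 2"
    unfolding l_def using upper_branch_bounds(3) by (intro cSUP_least) (auto intro: less_imp_le)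
  \<comment> \<open>If the limit stayed below \<open>pi / 2\<close>, the term with \<open>V\<close>
    would die out and the slope would tend to \<open>1\<close> instead of \<open>0\<close>.\<close>
  moreover have False if l': "l < pi / 2"
  proof -
    have "filterlim (\<lambda>t. (F t)\<^sup>2) at_top at_top"
      by (rule filterlim_pow_at_top[OF _ F]) simp
    then have "((\<lambda>t. 1 / (F t)\<^sup>2) \<longlongrightarrow> 0) at_top"
      by (intro tendsto_divide_0[OF tendsto_const] filterlim_at_top_imp_at_infinity)
    from deriv_limit_zero_at_top[OF upper_branch_DERIV lim upper_branch_rhs_tendsto[OF lim l l' this]]
    show False by simp
  qed
  ultimately have "l = pi / 2" by fastforce
  with lim show ?thesis by (simp only:)
qed

end

section \<open>Uniqueness of the upper branch and the limits of \<open>U\<close>\<close>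

lemma upper_branch_unique:
  assumes s: "upper_branch F \<epsilon> c s" and r: "upper_branch F \<epsilon> c r"
  shows "s = r"
proof
  fix t
  define D where "D t = (s t - r t)\<^sup>2" for t
  have anti: "D t \<le> D u" if "u \<le> t" for u
  proof (rule DERIV_nonpos_imp_nonincreasing[OF that])
    \<comment> \<open>Since \<open>V c\<close> increases on the strip, the larger of the two
      solutions has the smaller slope; thus the difference and its derivative have opposite
      signs.\<close>
    fix x
    have opp: "q x \<le> q' x \<Longrightarrow> sqrt (G x (q' x)) \<le> sqrt (G x (q x))"
      if "upper_branch F \<epsilon> c q" "upper_branch F \<epsilon> c q'" for q q'
    proof -
      assume "q x \<le> q' x"
      then have "V c (q x) \<le> V c (q' x)"
        using upper_branch_bounds[OF that(1), of x] upper_branch_bounds[OF that(2), of x]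
        by (intro V_mono) auto
      then show ?thesis using eps_pos by (simp add: divide_right_mono)
    qed
    have "(s x - r x) * (sqrt (G x (s x)) - sqrt (G x (r x))) \<le> 0"
      using opp[OF s r] opp[OF r s] by (cases "s x \<le> r x") (auto simp: mult_le_0_iff)
    moreover have "(D has_real_derivative 2 * ((s x - r x) * (sqrt (G x (s x)) - sqrt (G x (r x))))) (at x)"
      unfolding D_def
      by (auto intro!: derivative_eq_intros upper_branch_DERIV[OF s] upper_branch_DERIV[OF r])
    ultimately show "\<exists>y. (D has_real_derivative y) (at x) \<and> y \<le> 0"
      by (metis mult_nonneg_nonpos zero_le_numeral)
  qed
  \<comment> \<open>Both solutions tend to the same root at \<open>-\<infinity>\<close>, so
    \<open>D\<close> tends to \<open>0\<close> there; being nonincreasing and nonnegative, it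
    vanishes.\<close>
  have "(D \<longlongrightarrow> (U_root \<epsilon> c Fminus - U_root \<epsilon> c Fminus)\<^sup>2) at_bot"
    unfolding D_def by (intro tendsto_intros upper_branch_at_bot s r)
  then have "(D \<longlongrightarrow> 0) at_bot" by simp
  then have "D t \<le> 0"
    by (rule tendsto_lowerbound)
       (use anti in \<open>auto intro: eventually_mono[OF eventually_le_at_bot[of t]]\<close>)
  then show "s t = r t" by (simp add: D_def)
qed

text \<open>A nondecreasing \<open>F\<close> either is bounded and converges or tends to infinity;
  the two cases give different formulas for \<open>Uplus\<close>.\<close>

lemma upper_branch_limits:
  "\<exists>Uminus Uplus.
    (upper_root F \<epsilon> c \<longlongrightarrow> Uminus) at_bot \<and> (upper_root F \<epsilon> c \<longlongrightarrow> Uplus) at_top \<and>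
    (\<forall>s. upper_branch F \<epsilon> c s \<longrightarrow> (s \<longlongrightarrow> Uminus) at_bot \<and> (s \<longlongrightarrow> Uplus) at_top) \<and>
    (filterlim F at_top at_top \<longrightarrow> Uplus = pi / 2)"
proof -
  have bot: "(U \<longlongrightarrow> U_root \<epsilon> c Fminus) at_bot"
    by (rule isCont_tendsto_compose[OF isCont_U_root[OF eps_pos] Fminus_lim])
  show ?thesis
  proof (cases "bdd_above (range F)")
    case True
    define Fplus where "Fplus = (SUP t. F t)"
    have F: "(F \<longlongrightarrow> Fplus) at_top"
      unfolding Fplus_def by (rule mono_tendsto_SUP_at_top[OF F_mono True])
    have "(U \<longlongrightarrow> U_root \<epsilon> c Fplus) at_top"
      by (rule isCont_tendsto_compose[OF isCont_U_root[OF eps_pos] F])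
    \<comment> \<open>A finite limit excludes divergence, so the clause about \<open>pi / 2\<close>
      is vacuous in this case.\<close>
    moreover have "\<not> filterlim F at_top at_top"
      using F not_tendsto_and_filterlim_at_infinity[OF trivial_limit_at_top_linorder F]
        filterlim_at_top_imp_at_infinity by blast
    ultimately show ?thesis
      unfolding upper_root_eq using bot upper_branch_at_bot upper_branch_at_top_bounded[OF _ F] by blast
  next
    case False
    then have F: "filterlim F at_top at_top" by (rule mono_unbounded_at_top[OF F_mono])
    show ?thesis
      unfolding upper_root_eq
      using bot U_root_tendsto_pi_half[OF F eps_pos] upper_branch_at_bot upper_branch_at_top_unbounded[OF _ F] by blast
  qed
qed

end

subsection \<open>Reflection\<close>

text \<open>Reflection exchanges secant and cosecant; the factor \<open>c\<^sup>2\<close> moved into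
  \<open>\<epsilon>\<close> restores the normalization of the secant term.\<close>

lemma V_reflect:
  assumes "c \<noteq> 0"
  shows "\<epsilon> * c\<^sup>2 * V (1 / c) (pi / 2 - s) = \<epsilon> * V c s"
proof -
  have "sin (pi / 2 - s) = cos s" "cos (pi / 2 - s) = sin s"
    by (simp_all add: sin_diff cos_diff)
  then show ?thesis using assms by (simp add: V_def field_simps)
qed

lemma s_crit_reflect:
  assumes "c \<noteq> 0"
  shows "s_crit (1 / c) = pi / 2 - s_crit c"
proof -
  have "arctan (1 / sqrt \<bar>c\<bar>) = pi / 2 - arctan (sqrt \<bar>c\<bar>)"
    using assms arctan_inverse[of "sqrt \<bar>c\<bar>"] by (simp add: inverse_eq_divide)
  then show ?thesis by (simp add: s_crit_def real_sqrt_divide)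
qed

text \<open>The reflected problem has the same threshold, so the bound on \<open>Fminus\<close>
  carries over unchanged.\<close>

lemma threshold_reflect:
  fixes \<epsilon> c :: real
  assumes "c \<noteq> 0"
  shows "sqrt (\<epsilon> * c\<^sup>2) * (1 + \<bar>1 / c\<bar>) = sqrt \<epsilon> * (1 + \<bar>c\<bar>)"
  using assms by (simp add: real_sqrt_mult algebra_simps)

lemma entire_solution_reflect:
  assumes "c \<noteq> 0"
  shows "entire_solution F (\<epsilon> * c\<^sup>2) (1 / c) (\<lambda>t. pi / 2 - s t) \<longleftrightarrow> entire_solution F \<epsilon> c s"
    and "smooth_real s \<Longrightarrow> deriv (\<lambda>t. pi / 2 - s t) t = - deriv s t"
proof -
  have D: "deriv (\<lambda>t. pi / 2 - s t) t = - deriv s t" if "smooth_real s" for t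
    using DERIV_diff[OF DERIV_const smooth_real_DERIV[OF that]] by (auto intro!: DERIV_imp_deriv)
  then show "smooth_real s \<Longrightarrow> deriv (\<lambda>t. pi / 2 - s t) t = - deriv s t" .
  \<comment> \<open>Reflection is an involution, so preservation of smoothness in one direction
    gives the equivalence.\<close>
  have "smooth_real (\<lambda>t. pi / 2 - s t) \<longleftrightarrow> smooth_real s"
    using smooth_real_diff_const[of s "pi / 2"] smooth_real_diff_const[of "\<lambda>t. pi / 2 - s t" "pi / 2"] by auto
  then show "entire_solution F (\<epsilon> * c\<^sup>2) (1 / c) (\<lambda>t. pi / 2 - s t) \<longleftrightarrow> entire_solution F \<epsilon> c s"
    unfolding entire_solution_def V_reflect[OF assms] using D by (auto simp: conj_commute)
qed

text \<open>Reflection sends the interval beyond \<open>s_crit (1 / c)\<close> to the one before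
  \<open>s_crit c\<close> and preserves the root equation; uniqueness of the lower root identifies
  the two.\<close>

lemma lower_root_reflect:
  assumes c: "c \<noteq> 0" and \<epsilon>: "\<epsilon> > 0" and F: "sqrt \<epsilon> * (1 + \<bar>c\<bar>) < F t"
  shows "upper_root F (\<epsilon> * c\<^sup>2) (1 / c) t = pi / 2 - lower_root F \<epsilon> c t"
proof -
  have "lower_root F \<epsilon> c t = pi / 2 - upper_root F (\<epsilon> * c\<^sup>2) (1 / c) t"
    unfolding lower_root_def
  proof (rule the1_equality[OF ex1_lower_root[OF c \<epsilon> F]])
    have thr: "sqrt (\<epsilon> * c\<^sup>2) * (1 + \<bar>1 / c\<bar>) < F t"
      using F unfolding threshold_reflect[OF c] .
    define r where "r = upper_root F (\<epsilon> * c\<^sup>2) (1 / c) t"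
    have "s_crit (1 / c) < r \<and> r < pi / 2 \<and> \<epsilon> * c\<^sup>2 * V (1 / c) r = (F t)\<^sup>2"
      unfolding r_def upper_root_def using c \<epsilon> theI'[OF ex1_upper_root[of "1 / c" "\<epsilon> * c\<^sup>2", OF _ _ thr]] by simp
    then show "0 < pi / 2 - r \<and> pi / 2 - r < s_crit c \<and> \<epsilon> * V c (pi / 2 - r) = (F t)\<^sup>2"
      using V_reflect[OF c, of \<epsilon> "pi / 2 - r"] s_crit_reflect[OF c] by auto
  qed
  then show ?thesis by simp
qed

lemma lower_branch_reflect:
  assumes c: "c \<noteq> 0" and \<epsilon>: "\<epsilon> > 0" and F: "\<And>t. sqrt \<epsilon> * (1 + \<bar>c\<bar>) < F t"
  shows "upper_branch F (\<epsilon> * c\<^sup>2) (1 / c) (\<lambda>t. pi / 2 - s t) \<longleftrightarrow> lower_branch F \<epsilon> c s"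
proof -
  have "smooth_real s" if "entire_solution F \<epsilon> c s"
    using that by (simp add: entire_solution_def)
  then show ?thesis
    unfolding upper_branch_def lower_branch_def entire_solution_reflect(1)[OF c]
      lower_root_reflect[of c \<epsilon> F, OF c \<epsilon> F] s_crit_reflect[OF c]
    using entire_solution_reflect(2)[OF c] by auto
qed

section \<open>Necessity of the threshold and assembly of both branches\<close>

theorem theorem7p1:
  fixes F :: "real \<Rightarrow> real" and Fminus c \<epsilon> :: real
  assumes F_pos: "\<And>t. F t > 0"
    and F_smooth: "smooth_real F"
    and F_deriv: "\<And>t. deriv F t > 0"
    and Fminus_lim: "(F \<longlongrightarrow> Fminus) at_bot"
    and Fminus_inf: "Fminus = (INF t. F t)"
    and Fminus_pos: "Fminus > 0"
    and eps_pos: "\<epsilon> > 0"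
  shows "((\<exists>s. entire_solution F \<epsilon> c s) \<longleftrightarrow> sqrt \<epsilon> * (1 + \<bar>c\<bar>) \<le> Fminus) \<and>
    (sqrt \<epsilon> * (1 + \<bar>c\<bar>) \<le> Fminus \<longrightarrow>
      (c \<noteq> 0 \<longrightarrow>
        (\<exists>!s. upper_branch F \<epsilon> c s) \<and>
        (\<exists>!s. lower_branch F \<epsilon> c s) \<and>
        (\<exists>Uminus Uplus Lminus Lplus.
          (upper_root F \<epsilon> c \<longlongrightarrow> Uminus) at_bot \<and>
          (upper_root F \<epsilon> c \<longlongrightarrow> Uplus) at_top \<and>
          (lower_root F \<epsilon> c \<longlongrightarrow> Lminus) at_bot \<and>
          (lower_root F \<epsilon> c \<longlongrightarrow> Lplus) at_top \<and>
          (\<forall>s. upper_branch F \<epsilon> c s \<longrightarrow>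
             (s \<longlongrightarrow> Uminus) at_bot \<and> (s \<longlongrightarrow> Uplus) at_top) \<and>
          (\<forall>s. lower_branch F \<epsilon> c s \<longrightarrow>
             (s \<longlongrightarrow> Lminus) at_bot \<and> (s \<longlongrightarrow> Lplus) at_top) \<and>
          (filterlim F at_top at_top \<longrightarrow> Uplus = pi / 2 \<and> Lplus = 0))) \<and>
      (c = 0 \<longrightarrow>
        (\<exists>!s. upper_branch F \<epsilon> c s) \<and>
        (\<exists>Uminus Uplus.
          (upper_root F \<epsilon> c \<longlongrightarrow> Uminus) at_bot \<and>
          (upper_root F \<epsilon> c \<longlongrightarrow> Uplus) at_top \<and>
          (\<forall>s. upper_branch F \<epsilon> c s \<longrightarrow>
             (s \<longlongrightarrow> Uminus) at_bot \<and> (s \<longlongrightarrow> Uplus) at_top) \<and>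
          (filterlim F at_top at_top \<longrightarrow> Uplus = pi / 2))))"
proof -
  have below: "bdd_below (range F)" using F_pos by (auto intro!: bdd_belowI2 less_imp_le)
  have Fminus_less: "Fminus < F t" for t
  proof -
    \<comment> \<open>Comparison with an earlier time shows that the strictly increasing
      \<open>F\<close> does not attain its infimum.\<close>
    have "F (t - 1) < F t"
      by (rule DERIV_pos_imp_increasing) (use smooth_real_DERIV[OF F_smooth] F_deriv in auto)
    moreover have "Fminus \<le> F (t - 1)"
      unfolding Fminus_inf using below by (rule cINF_lower) simp
    ultimately show ?thesis by linarith
  qed
  have necessary: "sqrt \<epsilon> * (1 + \<bar>c\<bar>) \<le> Fminus" if s: "entire_solution F \<epsilon> c s" for s
    unfolding Fminus_inf
  proof (rule cINF_greatest)
    fix t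
    from s have st: "0 < s t" "s t < pi / 2" "(deriv s t)\<^sup>2 = 1 - \<epsilon> * V c (s t) / (F t)\<^sup>2"
      by (auto simp: entire_solution_def)
    \<comment> \<open>The right-hand side equals a square, and \<open>V\<close> is at least its
      minimum \<open>(1 + |c|)^2\<close>; the resulting bound at each \<open>t\<close> passes to the
      infimum.\<close>
    have "0 \<le> 1 - \<epsilon> * V c (s t) / (F t)\<^sup>2" unfolding st(3)[symmetric] by simp
    then have "\<epsilon> * V c (s t) \<le> (F t)\<^sup>2" using F_pos[of t] by simp
    then have "\<epsilon> * (1 + \<bar>c\<bar>)\<^sup>2 \<le> (F t)\<^sup>2"
      using V_ge[OF st(1,2), of c] eps_pos by (meson less_imp_le mult_left_mono order_trans)
    then have "(sqrt \<epsilon> * (1 + \<bar>c\<bar>))\<^sup>2 \<le> (F t)\<^sup>2"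
      using eps_pos by (simp add: power_mult_distrib)
    then show "sqrt \<epsilon> * (1 + \<bar>c\<bar>) \<le> F t" by (rule power2_le_imp_le[OF _ less_imp_le[OF F_pos]])
  qed simp
  have upper: "admissible_profile F \<epsilon> c Fminus" if "sqrt \<epsilon> * (1 + \<bar>c\<bar>) \<le> Fminus"
    by unfold_locales (use F_smooth F_deriv Fminus_lim Fminus_less eps_pos that in auto)
  have up1: "\<exists>!s. upper_branch F \<epsilon> c s" if "sqrt \<epsilon> * (1 + \<bar>c\<bar>) \<le> Fminus"
    using admissible_profile.upper_branch_exists[OF upper[OF that]]
      admissible_profile.upper_branch_unique[OF upper[OF that]] by blast
  have lower: "(\<exists>!s. lower_branch F \<epsilon> c s) \<and> (\<exists>Lminus Lplus.
      (lower_root F \<epsilon> c \<longlongrightarrow> Lminus) at_bot \<and> (lower_root F \<epsilon> c \<longlongrightarrow> Lplus) at_top \<and>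
      (\<forall>s. lower_branch F \<epsilon> c s \<longrightarrow> (s \<longlongrightarrow> Lminus) at_bot \<and> (s \<longlongrightarrow> Lplus) at_top) \<and>
      (filterlim F at_top at_top \<longrightarrow> Lplus = 0))"
    if thr: "sqrt \<epsilon> * (1 + \<bar>c\<bar>) \<le> Fminus" and c: "c \<noteq> 0"
  proof -
    have F: "sqrt \<epsilon> * (1 + \<bar>c\<bar>) < F t" for t using thr Fminus_less[of t] by linarith
    have "sqrt (\<epsilon> * c\<^sup>2) * (1 + \<bar>1 / c\<bar>) \<le> Fminus"
      using thr unfolding threshold_reflect[OF c] .
    then interpret refl: admissible_profile F "\<epsilon> * c\<^sup>2" "1 / c" Fminus
      by unfold_locales (use F_smooth F_deriv Fminus_lim Fminus_less eps_pos c in auto)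
    note branch = lower_branch_reflect[of c \<epsilon> F, OF c eps_pos F]
    have root: "upper_root F (\<epsilon> * c\<^sup>2) (1 / c) = (\<lambda>t. pi / 2 - lower_root F \<epsilon> c t)"
      by (intro ext lower_root_reflect c eps_pos F)
    have reflect_lim: "(f \<longlongrightarrow> pi / 2 - x) G" if "((\<lambda>t. pi / 2 - f t) \<longlongrightarrow> x) G" for f :: "real \<Rightarrow> real" and x G
      using tendsto_diff[OF tendsto_const that, of "pi / 2"] by simp
    obtain s where s: "upper_branch F (\<epsilon> * c\<^sup>2) (1 / c) s"
      using refl.upper_branch_exists by blast
    have "\<exists>!s. lower_branch F \<epsilon> c s"
    proof (rule ex_ex1I)
      show "\<exists>s. lower_branch F \<epsilon> c s"
        using branch[of "\<lambda>t. pi / 2 - s t"] s by auto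
      show "r = r'" if "lower_branch F \<epsilon> c r" "lower_branch F \<epsilon> c r'" for r r'
        using refl.upper_branch_unique[of "\<lambda>t. pi / 2 - r t" "\<lambda>t. pi / 2 - r' t"] that
        unfolding branch by (simp add: fun_eq_iff)
    qed
    moreover obtain Um Up where
      "(upper_root F (\<epsilon> * c\<^sup>2) (1 / c) \<longlongrightarrow> Um) at_bot" "(upper_root F (\<epsilon> * c\<^sup>2) (1 / c) \<longlongrightarrow> Up) at_top"
      "\<And>s. upper_branch F (\<epsilon> * c\<^sup>2) (1 / c) s \<Longrightarrow> (s \<longlongrightarrow> Um) at_bot \<and> (s \<longlongrightarrow> Up) at_top"
      "filterlim F at_top at_top \<Longrightarrow> Up = pi / 2"
      using refl.upper_branch_limits by blast
    \<comment> \<open>The limits of the lower root and lower branch are the reflected limits;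
      \<open>Up = pi / 2\<close> turns into \<open>Lplus = 0\<close>.\<close>
    then have "(lower_root F \<epsilon> c \<longlongrightarrow> pi / 2 - Um) at_bot" "(lower_root F \<epsilon> c \<longlongrightarrow> pi / 2 - Up) at_top"
      "\<And>s. lower_branch F \<epsilon> c s \<Longrightarrow> (s \<longlongrightarrow> pi / 2 - Um) at_bot \<and> (s \<longlongrightarrow> pi / 2 - Up) at_top"
      "filterlim F at_top at_top \<Longrightarrow> pi / 2 - Up = 0"
      unfolding root branch[symmetric] by (auto intro!: reflect_lim)
    ultimately show ?thesis by blast
  qed
  have ex: "(\<exists>s. entire_solution F \<epsilon> c s) \<longleftrightarrow> sqrt \<epsilon> * (1 + \<bar>c\<bar>) \<le> Fminus"
    using necessary up1 unfolding upper_branch_def by blast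
  show ?thesis
  proof (intro conjI[OF ex] impI conjI)
    assume thr: "sqrt \<epsilon> * (1 + \<bar>c\<bar>) \<le> Fminus"
    note U = admissible_profile.upper_branch_limits[OF upper[OF thr]]
    show "\<exists>!s. upper_branch F \<epsilon> c s" "\<exists>!s. upper_branch F \<epsilon> c s" using up1[OF thr] by simp_all
    show "\<exists>Uminus Uplus. (upper_root F \<epsilon> c \<longlongrightarrow> Uminus) at_bot \<and> (upper_root F \<epsilon> c \<longlongrightarrow> Uplus) at_top \<and>
      (\<forall>s. upper_branch F \<epsilon> c s \<longrightarrow> (s \<longlongrightarrow> Uminus) at_bot \<and> (s \<longlongrightarrow> Uplus) at_top) \<and>
      (filterlim F at_top at_top \<longrightarrow> Uplus = pi / 2)" by (rule U)
    assume c: "c \<noteq> 0"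
    show "\<exists>!s. lower_branch F \<epsilon> c s" using lower[OF thr c] by simp
    show "\<exists>Uminus Uplus Lminus Lplus.
      (upper_root F \<epsilon> c \<longlongrightarrow> Uminus) at_bot \<and> (upper_root F \<epsilon> c \<longlongrightarrow> Uplus) at_top \<and>
      (lower_root F \<epsilon> c \<longlongrightarrow> Lminus) at_bot \<and> (lower_root F \<epsilon> c \<longlongrightarrow> Lplus) at_top \<and>
      (\<forall>s. upper_branch F \<epsilon> c s \<longrightarrow> (s \<longlongrightarrow> Uminus) at_bot \<and> (s \<longlongrightarrow> Uplus) at_top) \<and>
      (\<forall>s. lower_branch F \<epsilon> c s \<longrightarrow> (s \<longlongrightarrow> Lminus) at_bot \<and> (s \<longlongrightarrow> Lplus) at_top) \<and>
      (filterlim F at_top at_top \<longrightarrow> Uplus = pi / 2 \<and> Lplus = 0)"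
      using U lower[OF thr c] by blast
  qed
qed

end
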